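(* For any $d\in\mathbb{N}$, any $s\in\mathbb{N}\cup\{\infty\}$ and any $n\in\mathbb{N}$ with $d<n\le 2^d$, $$a_n\left(H^s_{\rm mix}([0,1]^d)\hookrightarrow L_2([0,1]^d)\right)\ge 0.27\cdot n^{-c(d,n)},\quad\text{where}\quad c(d,n)=\frac{1.2825}{\log\left(1+\frac{2d}{\log_2 n}\right)}\le 1.17.$$
   Context: $\mathbb{N}=\{1,2,\dots\}$, $\log$ is the natural logarithm. For a compact linear operator $T:X\to Y$ between Hilbert spaces, $a_n(T)=\inf\{\|T-A\| : A:X\to Y\text{ bounded linear},\ \operatorname{rank}(A)<n\}$. For $s\in\mathbb{N}$, $H^s([0,1])=\{f\in L_2([0,1]) : f^{(l)}\in L_2([0,1]),\ 1\le l\le s\}$ (weak derivatives), and $H^\infty([0,1])=\{f\in C^\infty([0,1]) : \sum_{l=0}^\infty\|f^{(l)}\|_{L_2}^2<\infty\}$; both are Hilbert spaces with scalar product $\langle f,g\rangle_s=\sum_{l=0}^s\int_0^1 f^{(l)}(x)\overline{g^{(l)}(x)}\,dx$. $H^s_{\rm mix}([0,1]^d)$ is the $d$th Hilbert space tensor power of $H^s([0,1])$, realized as a space of functions on $[0,1]^d$; for finite $s$ it consists of all $f\in L_2([0,1]^d)$ with $D^\alpha f\in L_2([0,1]^d)$ for all $\alpha\in\{0,\dots,s\}^d$, with scalar product $\sum_{\alpha\in\{0,\dots,s\}^d}\langle D^\alpha f,D^\alpha g\rangle_{L_2}$. The symbol $\hookrightarrow$ denotes the (compact) embedding operator, i.e.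 the $d$th tensor power of the embedding $H^s([0,1])\hookrightarrow L_2([0,1])$. *)

theory Defs
  imports "HOL-Analysis.Analysis" "HOL-Library.Extended_Nat"
begin

text \<open>
  A Hilbert space of functions is given by a set \<open>X\<close> of representatives, closed under
  the pointwise operations, and a seminorm \<open>nX\<close>; functions at distance zero represent the
  same element. Operators are maps of representatives, and the equations expressing linearity hold
  up to functions of seminorm zero. With boundedness this makes them exactly the
  bounded linear operators between the quotient spaces.
\<close>

definition bounded_operator ::
  "('a \<Rightarrow> complex) set \<Rightarrow> (('a \<Rightarrow> complex) \<Rightarrow> real) \<Rightarrow>
   ('b \<Rightarrow> complex) set \<Rightarrow> (('b \<Rightarrow> complex) \<Rightarrow> real) \<Rightarrow>
   (('a \<Rightarrow> complex) \<Rightarrow> ('b \<Rightarrow> complex)) \<Rightarrow> bool" where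
  "bounded_operator X nX Y nY A \<longleftrightarrow>
     (\<forall>f\<in>X. A f \<in> Y) \<and>
     (\<forall>f\<in>X. \<forall>g\<in>X. nY (\<lambda>y. A (\<lambda>x. f x + g x) y - (A f y + A g y)) = 0) \<and>
     (\<forall>c. \<forall>f\<in>X. nY (\<lambda>y. A (\<lambda>x. c * f x) y - c * A f y) = 0) \<and>
     (\<exists>C. \<forall>f\<in>X. nY (A f) \<le> C * nX f)"

text \<open>
  The norm is \<open>ereal\<close>-valued only so that the supremum is meaningful without a
  boundedness proof.
\<close>

definition operator_norm ::
  "('a \<Rightarrow> complex) set \<Rightarrow> (('a \<Rightarrow> complex) \<Rightarrow> real) \<Rightarrow> (('b \<Rightarrow> complex) \<Rightarrow> real) \<Rightarrow>
   (('a \<Rightarrow> complex) \<Rightarrow> ('b \<Rightarrow> complex)) \<Rightarrow> ereal" where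
  "operator_norm X nX nY A = (SUP f\<in>{f \<in> X. nX f \<le> 1}. ereal (nY (A f)))"

text \<open>
  The dimension of the range (modulo functions of seminorm zero), i.e. the least number of
  elements of the range that span it; \<open>\<infinity>\<close> if there is no finite spanning family.
\<close>

definition operator_rank ::
  "('a \<Rightarrow> complex) set \<Rightarrow> (('b \<Rightarrow> complex) \<Rightarrow> real) \<Rightarrow>
   (('a \<Rightarrow> complex) \<Rightarrow> ('b \<Rightarrow> complex)) \<Rightarrow> enat" where
  "operator_rank X nY A =
     Inf {enat m |m. \<exists>b :: nat \<Rightarrow> 'b \<Rightarrow> complex. (\<forall>j<m. b j \<in> A ` X) \<and>
            (\<forall>f\<in>X. \<exists>c. nY (\<lambda>y. A f y - (\<Sum>j<m. c j * b j y)) = 0)}"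

definition approx_number ::
  "nat \<Rightarrow> ('a \<Rightarrow> complex) set \<Rightarrow> (('a \<Rightarrow> complex) \<Rightarrow> real) \<Rightarrow>
   ('b \<Rightarrow> complex) set \<Rightarrow> (('b \<Rightarrow> complex) \<Rightarrow> real) \<Rightarrow>
   (('a \<Rightarrow> complex) \<Rightarrow> ('b \<Rightarrow> complex)) \<Rightarrow> ereal" where
  "approx_number n X nX Y nY T =
     (INF A\<in>{A. bounded_operator X nX Y nY A \<and> operator_rank X nY A < enat n}.
        operator_norm X nX nY (\<lambda>f y. T f y - A f y))"

definition L2_space :: "'a measure \<Rightarrow> ('a \<Rightarrow> complex) set" where
  "L2_space M = {f \<in> borel_measurable M. integrable M (\<lambda>x. (cmod (f x))\<^sup>2)}"

definition L2_norm :: "'a measure \<Rightarrow> ('a \<Rightarrow> complex) \<Rightarrow> real" where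
  "L2_norm M f = sqrt (LINT x|M. (cmod (f x))\<^sup>2)"

definition L2_inner :: "'a measure \<Rightarrow> ('a \<Rightarrow> complex) \<Rightarrow> ('a \<Rightarrow> complex) \<Rightarrow> complex" where
  "L2_inner M f g = (LINT x|M. f x * cnj (g x))"

definition unit_interval :: "real measure" where
  "unit_interval = restrict_space lborel {0..1}"

text \<open>
  Points of \<open>[0,1]\<^sup>d\<close> are functions on \<open>{..<d}\<close>.
\<close>

definition unit_cube :: "nat \<Rightarrow> (nat \<Rightarrow> real) measure" where
  "unit_cube d = PiM {..<d} (\<lambda>_. unit_interval)"

definition test_function :: "(real \<Rightarrow> real) \<Rightarrow> bool" where
  "test_function \<phi> \<longleftrightarrow>
     (\<forall>k x. (deriv ^^ k) \<phi> differentiable (at x)) \<and>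
     (\<exists>a b. 0 < a \<and> b < 1 \<and> (\<forall>x. x \<notin> {a..b} \<longrightarrow> \<phi> x = 0))"

definition is_weak_deriv :: "nat \<Rightarrow> (real \<Rightarrow> complex) \<Rightarrow> (real \<Rightarrow> complex) \<Rightarrow> bool" where
  "is_weak_deriv l f g \<longleftrightarrow>
     (\<forall>\<phi>. test_function \<phi> \<longrightarrow>
        (LINT x|unit_interval. f x * of_real ((deriv ^^ l) \<phi> x)) =
        (-1) ^ l * (LINT x|unit_interval. g x * of_real (\<phi> x)))"

text \<open>
  One-sided derivatives at the end points.
\<close>

definition interval_deriv :: "(real \<Rightarrow> complex) \<Rightarrow> real \<Rightarrow> complex" where
  "interval_deriv f = (\<lambda>x. vector_derivative f (at x within {0..1}))"

definition smooth_on_interval :: "(real \<Rightarrow> complex) \<Rightarrow> bool" where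
  "smooth_on_interval f \<longleftrightarrow> (\<forall>k. (interval_deriv ^^ k) f differentiable_on {0..1})"

definition sobolev :: "enat \<Rightarrow> (real \<Rightarrow> complex) set" where
  "sobolev s = (case s of
      enat r \<Rightarrow> {f \<in> L2_space unit_interval.
                   \<forall>l\<in>{1..r}. \<exists>g \<in> L2_space unit_interval. is_weak_deriv l f g}
    | \<infinity> \<Rightarrow> {f. smooth_on_interval f \<and>
                 summable (\<lambda>l. (L2_norm unit_interval ((interval_deriv ^^ l) f))\<^sup>2)})"

text \<open>
  The \<open>l\<close>-th derivative of \<open>f \<in> sobolev s\<close>. Weak derivatives are unique up to
  null sets, so the choice does not affect the integrals below.
\<close>

definition sobolev_deriv :: "enat \<Rightarrow> nat \<Rightarrow> (real \<Rightarrow> complex) \<Rightarrow> real \<Rightarrow> complex" where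
  "sobolev_deriv s l f = (case s of
      enat r \<Rightarrow> (SOME g. g \<in> L2_space unit_interval \<and> is_weak_deriv l f g)
    | \<infinity> \<Rightarrow> (interval_deriv ^^ l) f)"

definition sobolev_inner :: "enat \<Rightarrow> (real \<Rightarrow> complex) \<Rightarrow> (real \<Rightarrow> complex) \<Rightarrow> complex" where
  "sobolev_inner s f g =
     (\<Sum>\<^sub>\<infinity>l\<in>{l. enat l \<le> s}. L2_inner unit_interval (sobolev_deriv s l f) (sobolev_deriv s l g))"

text \<open>
  A list of pairs \<open>(c, F)\<close> stands for the element of the algebraic tensor power
  that is the sum of the \<open>c\<close>-multiples of the elementary tensors
  \<open>F 0 \<otimes> \<dots> \<otimes> F (d - 1)\<close>.
\<close>

type_synonym tensor = "(complex \<times> (nat \<Rightarrow> real \<Rightarrow> complex)) list"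

definition algebraic_tensors :: "enat \<Rightarrow> nat \<Rightarrow> tensor set" where
  "algebraic_tensors s d = {xs. \<forall>(c, F)\<in>set xs. \<forall>i<d. F i \<in> sobolev s}"

definition tensor_diff :: "tensor \<Rightarrow> tensor \<Rightarrow> tensor" where
  "tensor_diff xs ys = xs @ map (\<lambda>(c, F). (- c, F)) ys"

definition tensor_fun :: "nat \<Rightarrow> tensor \<Rightarrow> (nat \<Rightarrow> real) \<Rightarrow> complex" where
  "tensor_fun d xs x = (\<Sum>(c, F)\<leftarrow>xs. c * (\<Prod>i<d. F i (x i)))"

definition tensor_inner :: "enat \<Rightarrow> nat \<Rightarrow> tensor \<Rightarrow> tensor \<Rightarrow> complex" where
  "tensor_inner s d xs ys =
     (\<Sum>(c, F)\<leftarrow>xs. \<Sum>(c', G)\<leftarrow>ys. c * cnj c' * (\<Prod>i<d. sobolev_inner s (F i) (G i)))"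

text \<open>
  The inner product of a tensor with itself is real and nonnegative; \<open>cmod\<close> only
  converts it to a real number.
\<close>

definition tensor_norm :: "enat \<Rightarrow> nat \<Rightarrow> tensor \<Rightarrow> real" where
  "tensor_norm s d xs = sqrt (cmod (tensor_inner s d xs xs))"

definition tensor_Cauchy :: "enat \<Rightarrow> nat \<Rightarrow> (nat \<Rightarrow> tensor) \<Rightarrow> bool" where
  "tensor_Cauchy s d X \<longleftrightarrow>
     (\<forall>e>0. \<exists>N. \<forall>j\<ge>N. \<forall>k\<ge>N. tensor_norm s d (tensor_diff (X j) (X k)) < e)"

text \<open>
  The completion of the algebraic tensor power consists of (classes of) Cauchy sequences of
  tensors. Such a sequence also converges in \<open>L\<^sub>2\<close>, and its limit realizes the
  corresponding element of the completion as a function.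
\<close>

definition represents :: "enat \<Rightarrow> nat \<Rightarrow> (nat \<Rightarrow> tensor) \<Rightarrow> ((nat \<Rightarrow> real) \<Rightarrow> complex) \<Rightarrow> bool" where
  "represents s d X u \<longleftrightarrow>
     (\<forall>k. X k \<in> algebraic_tensors s d) \<and> tensor_Cauchy s d X \<and>
     (\<lambda>k. L2_norm (unit_cube d) (\<lambda>x. u x - tensor_fun d (X k) x)) \<longlonglongrightarrow> 0"

definition sobolev_mix :: "enat \<Rightarrow> nat \<Rightarrow> ((nat \<Rightarrow> real) \<Rightarrow> complex) set" where
  "sobolev_mix s d = {u \<in> L2_space (unit_cube d). \<exists>X. represents s d X u}"

text \<open>
  The norm transported from the completion. Tensor powers of injective operators between Hilbert
  spaces are injective, so all sequences representing \<open>u\<close> define the same element of the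
  completion: the set below has exactly one element and \<open>Inf\<close> selects it.
\<close>

definition sobolev_mix_norm :: "enat \<Rightarrow> nat \<Rightarrow> ((nat \<Rightarrow> real) \<Rightarrow> complex) \<Rightarrow> real" where
  "sobolev_mix_norm s d u =
     Inf {r. \<exists>X. represents s d X u \<and> (\<lambda>k. tensor_norm s d (X k)) \<longlonglongrightarrow> r}"

definition sobolev_mix_approx_number :: "nat \<Rightarrow> enat \<Rightarrow> nat \<Rightarrow> ereal" where
  "sobolev_mix_approx_number n s d =
     approx_number n (sobolev_mix s d) (sobolev_mix_norm s d)
       (L2_space (unit_cube d)) (L2_norm (unit_cube d)) (\<lambda>u. u)"

end

theory Submission
  imports Defs "HOL-Computational_Algebra.Polynomial"
begin

text \<open>
  The polynomials \<open>1\<close>, \<open>x - 1/2\<close> and \<open>x\<^sup>2 - x + 1/6\<close> are orthogonal in \<open>L\<^sub>2([0,1])\<close> and in \<open>H\<^sup>s([0,1])\<close>,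
  and for every \<open>s\<close> the squared ratios of their two norms are at least \<open>1\<close>, \<open>1/13\<close> and \<open>1/781\<close>.
  Any \<open>n\<close> of their \<open>d\<close>-fold products on which the squared ratio is at least \<open>\<epsilon>\<^sup>2\<close> span a space on which
  an operator of rank less than \<open>n\<close> has a nontrivial kernel, so the \<open>n\<close>-th approximation number is
  at least \<open>\<epsilon>\<close>.

  With at most \<open>k\<close> linear factors this gives \<open>13\<^sup>-\<^sup>k\<^sup>/\<^sup>2\<close>, and \<open>1.2825\<close> is slightly more than
  \<open>ln 13 / 2\<close>. What remains is to find \<open>k\<close> with at least \<open>n\<close> products and
  \<open>(1 + 2d / log\<^sub>2 n)\<^sup>k\<^sup>-\<^sup>1 \<le> n\<close>. The linear factors suffice for \<open>n \<le> 2\<^sup>d\<^sup>-\<^sup>1\<close>. Closer to \<open>2\<^sup>d\<close> they do not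
  (\<open>13\<^sup>-\<^sup>d\<^sup>/\<^sup>2\<close> is too small at \<open>n = 2\<^sup>d\<close>), and products with one quadratic factor are needed, which
  count as three linear ones because \<open>781 \<le> 13\<^sup>3\<close>.
\<close>

subsection \<open>Smooth functions of compact support\<close>

text \<open>Peels off the innermost derivative, so that closure under sums, products and
  \<open>exp\<close> follows by induction on \<open>k\<close>; \<open>diff_upto_iff\<close>
  translates this to the iterates that occur in \<open>test_function\<close>.\<close>

primrec diff_upto :: "nat \<Rightarrow> (real \<Rightarrow> real) \<Rightarrow> bool" where
  "diff_upto 0 f \<longleftrightarrow> True"
| "diff_upto (Suc k) f \<longleftrightarrow> (\<forall>x. f differentiable at x) \<and> diff_upto k (deriv f)"

lemma diff_upto_iff: "diff_upto k f \<longleftrightarrow> (\<forall>j<k. \<forall>x. (deriv ^^ j) f differentiable at x)"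
proof (induction k arbitrary: f)
  case (Suc k)
  have "(\<forall>j<Suc k. P j) \<longleftrightarrow> P 0 \<and> (\<forall>j<k. P (Suc j))" for P :: "nat \<Rightarrow> bool"
    using less_Suc_eq_0_disj by auto
  then show ?case
    by (simp add: Suc.IH funpow_Suc_right del: funpow.simps(2))
qed simp

lemma has_deriv_imp_deriv:
  "(\<And>x. (f has_real_derivative f' x) (at x)) \<Longrightarrow> deriv f = f'"
  by (auto intro!: ext DERIV_imp_deriv)

lemma diff_upto_SucI:
  assumes "\<And>x. (f has_real_derivative f' x) (at x)" and "diff_upto k f'"
  shows "diff_upto (Suc k) f"
  using assms has_deriv_imp_deriv[of f f'] real_differentiable_def by auto

lemma diff_upto_SucD:
  assumes "diff_upto (Suc k) f"
  shows "(f has_real_derivative deriv f x) (at x)" and "diff_upto k (deriv f)"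
  using assms by (auto simp: DERIV_deriv_iff_real_differentiable)

lemma diff_upto_Suc_imp: "diff_upto (Suc k) f \<Longrightarrow> diff_upto k f"
  by (simp add: diff_upto_iff)

lemma diff_upto_const: "diff_upto k (\<lambda>_. c)"
proof (induction k arbitrary: c)
  case (Suc k)
  have "\<And>x. ((\<lambda>_. c) has_real_derivative 0) (at x)" by simp
  then show ?case by (rule diff_upto_SucI) (rule Suc.IH)
qed simp

lemma diff_upto_add: "diff_upto k f \<Longrightarrow> diff_upto k g \<Longrightarrow> diff_upto k (\<lambda>x. f x + g x)"
proof (induction k arbitrary: f g)
  case (Suc k)
  have "\<And>x. ((\<lambda>x. f x + g x) has_real_derivative deriv f x + deriv g x) (at x)"
    by (intro DERIV_add diff_upto_SucD(1)[OF Suc.prems(1)] diff_upto_SucD(1)[OF Suc.prems(2)])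
  then show ?case
    by (rule diff_upto_SucI[OF _ Suc.IH[OF Suc.prems[THEN diff_upto_SucD(2)]]])
qed simp

lemma diff_upto_mult: "diff_upto k f \<Longrightarrow> diff_upto k g \<Longrightarrow> diff_upto k (\<lambda>x. f x * g x)"
proof (induction k arbitrary: f g)
  case (Suc k)
  have "\<And>x. ((\<lambda>x. f x * g x) has_real_derivative (deriv f x * g x + deriv g x * f x)) (at x)"
    by (intro DERIV_mult diff_upto_SucD(1)[OF Suc.prems(1)] diff_upto_SucD(1)[OF Suc.prems(2)])
  moreover have "diff_upto k (\<lambda>x. deriv f x * g x + deriv g x * f x)"
    by (rule diff_upto_add[OF Suc.IH Suc.IH]; rule diff_upto_Suc_imp diff_upto_SucD(2); rule Suc.prems)
  ultimately show ?case by (rule diff_upto_SucI)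
qed simp

lemma diff_upto_compose_affine: "diff_upto k f \<Longrightarrow> diff_upto k (\<lambda>x. f (c * x + b))"
proof (induction k arbitrary: f)
  case (Suc k)
  have "((\<lambda>x. f (c * x + b)) has_real_derivative c * deriv f (c * x + b)) (at x)" for x
  proof -
    have "((\<lambda>x. c * x + b) has_real_derivative c) (at x)"
      by (auto intro!: derivative_eq_intros)
    from DERIV_chain2[OF diff_upto_SucD(1)[OF Suc.prems] this] show ?thesis
      by (simp add: mult.commute)
  qed
  moreover have "diff_upto k (\<lambda>x. c * deriv f (c * x + b))"
    by (rule diff_upto_mult[OF diff_upto_const Suc.IH[OF diff_upto_SucD(2)[OF Suc.prems]]])
  ultimately show ?case by (rule diff_upto_SucI)
qed simp

lemma diff_upto_exp: "diff_upto k f \<Longrightarrow> diff_upto k (\<lambda>x. exp (f x))"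
proof (induction k)
  case (Suc k)
  have "\<And>x. ((\<lambda>x. exp (f x)) has_real_derivative (exp (f x) * deriv f x)) (at x)"
    by (rule DERIV_chain2[OF DERIV_exp diff_upto_SucD(1)[OF Suc.prems]])
  moreover have "diff_upto k (\<lambda>x. exp (f x) * deriv f x)"
    by (rule diff_upto_mult[OF Suc.IH[OF diff_upto_Suc_imp[OF Suc.prems]] diff_upto_SucD(2)[OF Suc.prems]])
  ultimately show ?case by (rule diff_upto_SucI)
qed simp

text \<open>The factor \<open>p\<close> makes this family of flat functions closed under derivatives.\<close>

definition flat :: "real poly \<Rightarrow> real \<Rightarrow> real" where
  "flat p x = (if x \<le> 0 then 0 else poly p (1 / x) * exp (- (1 / x)))"

text \<open>The power \<open>x ^ k\<close> is carried along for the induction on coefficients: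
  \<open>pCons a p\<close> splits into \<open>a * x ^ k\<close> and \<open>x ^ Suc k\<close> times
  \<open>p\<close>.\<close>

lemma poly_div_exp_tendsto_0: "((\<lambda>x. x ^ k * poly p x / exp x) \<longlongrightarrow> (0::real)) at_top"
proof (induction p arbitrary: k)
  case (pCons a p)
  have "((\<lambda>x. a * (x ^ k / exp x) + x ^ Suc k * poly p x / exp x) \<longlongrightarrow> a * 0 + 0) at_top"
    by (intro tendsto_intros tendsto_power_div_exp_0 pCons.IH)
  moreover have "(\<lambda>x. a * (x ^ k / exp x) + x ^ Suc k * poly p x / exp x)
     = (\<lambda>x. x ^ k * poly (pCons a p) x / exp x)"
    by (auto simp: field_simps)
  ultimately show ?case by simp
qed simp

text \<open>Right of 0 this is the chain rule; \<open>[:0, 0, 1:]\<close> is the square of the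
  variable and comes from differentiating \<open>1 / x\<close>. At 0 the exponential beats every
  polynomial in \<open>1 / x\<close>.\<close>

lemma flat_has_derivative:
  "(flat p has_real_derivative flat ([:0, 0, 1:] * (p - pderiv p)) x) (at x)"
proof -
  consider "x < 0" | "x > 0" | "x = 0" by linarith
  then show ?thesis
  proof cases
    case 1
    have "((\<lambda>_. 0) has_real_derivative 0) (at x)" by simp
    moreover have "\<forall>\<^sub>F y in nhds x. flat p y = 0"
      by (rule eventually_mono[OF eventually_nhds_in_open[of "{..<0}" x]]) (use 1 in \<open>auto simp: flat_def\<close>)
    ultimately have "(flat p has_real_derivative 0) (at x)"
      using DERIV_cong_ev[of x x "flat p" "\<lambda>_. 0" 0 0] by simp
    then show ?thesis using 1 by (simp add: flat_def)
  next
    case 2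
    have "((\<lambda>y. 1 / y) has_real_derivative - (1 / x ^ 2)) (at x)"
      using 2 by (auto intro!: derivative_eq_intros simp: power2_eq_square)
    note inv = this
    have "((\<lambda>y. poly p (1 / y)) has_real_derivative poly (pderiv p) (1 / x) * - (1 / x ^ 2)) (at x)"
      by (rule DERIV_chain2[OF poly_DERIV inv])
    moreover have "((\<lambda>y. exp (- (1 / y))) has_real_derivative exp (- (1 / x)) * (1 / x ^ 2)) (at x)"
      using DERIV_chain2[OF DERIV_exp DERIV_minus[OF inv]] by simp
    ultimately have "((\<lambda>y. poly p (1 / y) * exp (- (1 / y))) has_real_derivative
       poly (pderiv p) (1 / x) * - (1 / x ^ 2) * exp (- (1 / x))
       + exp (- (1 / x)) * (1 / x ^ 2) * poly p (1 / x)) (at x)"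
      by (rule DERIV_mult)
    moreover have "poly (pderiv p) (1 / x) * - (1 / x ^ 2) * exp (- (1 / x))
       + exp (- (1 / x)) * (1 / x ^ 2) * poly p (1 / x) = flat ([:0, 0, 1:] * (p - pderiv p)) x"
      using 2 by (simp add: flat_def field_simps power2_eq_square)
    moreover have "\<forall>\<^sub>F y in nhds x. flat p y = poly p (1 / y) * exp (- (1 / y))"
      by (rule eventually_mono[OF eventually_nhds_in_open[of "{0<..}" x]]) (use 2 in \<open>auto simp: flat_def\<close>)
    ultimately show ?thesis
      using DERIV_cong_ev[of x x "flat p" "\<lambda>y. poly p (1 / y) * exp (- (1 / y))"] by simp
  next
    case 3
    \<comment> \<open>In the variable \<open>1 / h\<close> the right-hand difference quotient at 0
      is a polynomial divided by \<open>exp\<close>.\<close>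
    have "((\<lambda>h. (1 / h) ^ 1 * poly p (1 / h) / exp (1 / h)) \<longlongrightarrow> 0) (at_right 0)"
      by (rule filterlim_compose[OF poly_div_exp_tendsto_0])
        (use filterlim_inverse_at_top_right in \<open>simp add: inverse_eq_divide\<close>)
    moreover have "\<forall>\<^sub>F h in at_right 0. flat p h / h = (1 / h) ^ 1 * poly p (1 / h) / exp (1 / h)"
      by (auto simp: flat_def exp_minus field_simps eventually_at_right_less
          intro!: eventually_mono[OF eventually_at_right_less[of "0::real"]])
    ultimately have "((\<lambda>h. flat p h / h) \<longlongrightarrow> 0) (at_right 0)"
      by (simp add: tendsto_cong)
    moreover have "((\<lambda>h. flat p h / h) \<longlongrightarrow> 0) (at_left 0)"
    proof (rule Lim_transform_eventually[OF tendsto_const])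
      show "\<forall>\<^sub>F h in at_left 0. 0 = flat p h / h"
        by (auto simp: flat_def eventually_at_filter)
    qed
    ultimately have "((\<lambda>h. flat p h / h) \<longlongrightarrow> 0) (at 0)"
      by (rule filterlim_split_at[rotated])
    then show ?thesis
      using 3 by (simp add: has_field_derivative_iff flat_def[of _ 0] flat_def[of p 0])
  qed
qed

lemma diff_upto_flat: "diff_upto k (flat p)"
proof (induction k arbitrary: p)
  case (Suc k)
  show ?case by (rule diff_upto_SucI[OF flat_has_derivative Suc])
qed simp

text \<open>The product of the two flat functions is positive exactly on the open interval from
  \<open>a\<close> to \<open>b\<close>. Growing \<open>n\<close> drives the values there up to 1, so
  these smooth functions increase to its indicator.\<close>

definition bump :: "real \<Rightarrow> real \<Rightarrow> nat \<Rightarrow> real \<Rightarrow> real" where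
  "bump a b n x = 1 - exp (- real n * (flat 1 (x - a) * flat 1 (b - x)))"

lemma diff_upto_bump: "diff_upto k (bump a b n)"
proof -
  have "diff_upto k (\<lambda>x. 1 + (-1) * exp (- real n * (flat 1 (1 * x + - a) * flat 1 ((-1) * x + b))))"
    by (intro diff_upto_add diff_upto_mult diff_upto_const diff_upto_exp
        diff_upto_compose_affine[where f = "flat 1"] diff_upto_flat)
  then show ?thesis by (simp add: bump_def[abs_def])
qed

lemma bump_bounds: "0 \<le> bump a b n x" "bump a b n x \<le> 1"
  by (auto simp: bump_def flat_def)

lemma bump_outside: "x \<notin> {a<..<b} \<Longrightarrow> bump a b n x = 0"
  by (auto simp: bump_def flat_def)

lemma bump_tendsto_indicator: "(\<lambda>n. bump a b n x) \<longlonglongrightarrow> indicator {a<..<b} x"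
proof (cases "x \<in> {a<..<b}")
  case True
  define t where "t = flat 1 (x - a) * flat 1 (b - x)"
  have "t > 0" using True by (simp add: t_def flat_def)
  then have "filterlim (\<lambda>n. t * real n) at_top sequentially"
    by (intro filterlim_tendsto_pos_mult_at_top[OF tendsto_const _ filterlim_real_sequentially])
  then have "filterlim (\<lambda>n. - (t * real n)) at_bot sequentially"
    by (simp add: filterlim_uminus_at_top)
  then have "(\<lambda>n. exp (- (t * real n))) \<longlonglongrightarrow> 0"
    by (rule filterlim_compose[OF exp_at_bot])
  then have "(\<lambda>n. 1 - exp (- (t * real n))) \<longlonglongrightarrow> 1 - 0"
    by (intro tendsto_intros)
  then show ?thesis using True by (simp add: bump_def t_def ac_simps)
qed (simp add: bump_outside)

lemma test_function_bump: "0 < a \<Longrightarrow> b < 1 \<Longrightarrow> test_function (bump a b n)"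
  unfolding test_function_def
proof (intro conjI allI exI)
  show "(deriv ^^ k) (bump a b n) differentiable at x" for k x
    using diff_upto_bump[of "Suc k" a b n] unfolding diff_upto_iff by blast
  show "x \<notin> {a..b} \<longrightarrow> bump a b n x = 0" for x
    by (auto intro: bump_outside)
qed auto

subsection \<open>The fundamental lemma of the calculus of variations\<close>

text \<open>The positive and negative parts of \<open>f\<close> are densities of two finite measures
  that agree on all open rays and hence coincide. So the two parts are equal almost everywhere,
  which forces \<open>f\<close> to vanish there.\<close>

lemma AE_eq_0_if_integral_greaterThan_0:
  fixes f :: "real \<Rightarrow> real"
  assumes f: "integrable lborel f"
    and zero: "\<And>a. (LINT x|lborel. indicator {a<..} x * f x) = 0"
  shows "AE x in lborel. f x = 0"
proof -
  have [measurable]: "f \<in> borel_measurable borel"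
    using borel_measurable_integrable[OF f] by simp
  have pos: "(\<integral>\<^sup>+x. ennreal (g x) \<partial>lborel) = (\<integral>\<^sup>+x. ennreal (- g x) \<partial>lborel)"
    and fin: "(\<integral>\<^sup>+x. ennreal (g x) \<partial>lborel) < \<infinity>"
    if "integrable lborel g" and "integral\<^sup>L lborel g = 0" for g :: "real \<Rightarrow> real"
  proof -
    have 1: "(\<integral>\<^sup>+x. ennreal (g x) \<partial>lborel) \<noteq> \<infinity>" "(\<integral>\<^sup>+x. ennreal (- g x) \<partial>lborel) \<noteq> \<infinity>"
      using that(1) by (auto simp: real_integrable_def)
    have "enn2real (\<integral>\<^sup>+x. ennreal (g x) \<partial>lborel) = enn2real (\<integral>\<^sup>+x. ennreal (- g x) \<partial>lborel)"
      using that(2) by (simp add: real_lebesgue_integral_def[OF that(1)])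
    then show "(\<integral>\<^sup>+x. ennreal (g x) \<partial>lborel) = (\<integral>\<^sup>+x. ennreal (- g x) \<partial>lborel)"
      using 1 by (metis ennreal_enn2real infinity_ennreal_def top.not_eq_extremum)
    show "(\<integral>\<^sup>+x. ennreal (g x) \<partial>lborel) < \<infinity>"
      using 1 by (simp add: less_top)
  qed
  have tail: "integrable lborel (\<lambda>x. indicator {a<..} x * f x)" for a
    using integrable_mult_indicator[OF _ f, of "{a<..}"] by simp
  have em: "emeasure (density lborel (\<lambda>x. ennreal (g x))) {a<..}
      = (\<integral>\<^sup>+x. ennreal (indicator {a<..} x * g x) \<partial>lborel)"
    if [measurable]: "g \<in> borel_measurable borel" for a and g :: "real \<Rightarrow> real"
    by (subst emeasure_density) (auto intro!: nn_integral_cong split: split_indicator)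
  have "density lborel (\<lambda>x. ennreal (f x)) = density lborel (\<lambda>x. ennreal (- f x))"
  proof (rule measure_eqI_lessThan)
    fix a :: real
    show "emeasure (density lborel (\<lambda>x. ennreal (f x))) {a<..} < \<infinity>"
      using fin[OF tail zero] by (simp add: em)
    show "emeasure (density lborel (\<lambda>x. ennreal (f x))) {a<..}
        = emeasure (density lborel (\<lambda>x. ennreal (- f x))) {a<..}"
      using pos[OF tail zero] by (simp add: em)
  qed auto
  then have "AE x in lborel. ennreal (f x) = ennreal (- f x)"
    using f by (subst (asm) finite_density_unique) (auto simp: real_integrable_def)
  then show ?thesis
  proof eventually_elim
    case (elim x)
    show ?case
    proof (rule ccontr)
      assume "f x \<noteq> 0"
      \<comment> \<open>\<open>ennreal\<close> sends negative numbers to 0, so exactly one of the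
        two equal values would be positive.\<close>
      then consider "f x > 0" "- f x \<le> 0" | "- f x > 0" "f x \<le> 0" by linarith
      then show False using elim by cases (auto simp: ennreal_neg ennreal_eq_0_iff)
    qed
  qed
qed

section \<open>The unit interval as a finite measure space\<close>

lemma space_unit_interval [simp]: "space unit_interval = {0..1}"
  by (simp add: unit_interval_def)

lemma emeasure_unit_interval: "emeasure unit_interval {0..1} = 1"
  by (simp add: unit_interval_def emeasure_restrict_space)

interpretation unit_interval: finite_measure unit_interval
  by (rule finite_measureI) (simp add: emeasure_unit_interval)

lemma integral_unit_interval:
  "integral\<^sup>L unit_interval f = (LINT x|lborel. indicator {0..1} x *\<^sub>R f x)"
  for f :: "real \<Rightarrow> 'a::{banach, second_countable_topology}"
  by (simp add: unit_interval_def integral_restrict_space)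

lemma integrable_unit_interval:
  "integrable unit_interval f \<longleftrightarrow> integrable lborel (\<lambda>x. indicator {0..1} x *\<^sub>R f x)"
  for f :: "real \<Rightarrow> 'a::{banach, second_countable_topology}"
  by (simp add: unit_interval_def integrable_restrict_space)

lemma measurable_unit_interval:
  "f \<in> borel_measurable borel \<Longrightarrow> f \<in> borel_measurable unit_interval"
  unfolding unit_interval_def by (rule measurable_restrict_space1) simp

lemma measurable_bump: "bump a b n \<in> borel_measurable borel"
proof -
  have "isCont (bump a b n) x" for x
    using diff_upto_bump[of 1 a b n] by (auto simp: diff_upto_iff differentiable_imp_continuous_within)
  then show ?thesis
    by (intro borel_measurable_continuous_onI continuous_at_imp_continuous_on) auto
qed

text \<open>Supports of test functions stay away from 0 and 1, so dominated convergence is used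
  twice: bumps tend to indicators of intervals with end points inside, and such intervals exhaust
  those that reach 0 or 1.\<close>

lemma integral_open_interval_eq_0:
  fixes h :: "real \<Rightarrow> complex"
  assumes h: "integrable unit_interval h"
    and zero: "\<And>\<phi>. test_function \<phi> \<Longrightarrow> (LINT x|unit_interval. h x * of_real (\<phi> x)) = 0"
    and "0 \<le> a" "b \<le> 1"
  shows "(LINT x|unit_interval. indicator {a<..<b} x *\<^sub>R h x) = 0"
proof -
  have [measurable]: "h \<in> borel_measurable unit_interval"
    using h by (rule borel_measurable_integrable)
  have [measurable]: "bump a b n \<in> borel_measurable unit_interval" for a b n
    by (intro measurable_unit_interval measurable_bump)
  have [measurable]: "(indicator {a<..<b} :: real \<Rightarrow> real) \<in> borel_measurable unit_interval" for a b
    by (intro measurable_unit_interval) auto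
  have interior: "(LINT x|unit_interval. indicator {a<..<b} x *\<^sub>R h x) = 0"
    if "0 < a" "b < 1" for a b
  proof (rule LIMSEQ_unique)
    show "(\<lambda>n. LINT x|unit_interval. h x * of_real (bump a b n x))
        \<longlonglongrightarrow> (LINT x|unit_interval. indicator {a<..<b} x *\<^sub>R h x)"
    proof (rule integral_dominated_convergence[where w = "\<lambda>x. norm (h x)"])
      show "AE x in unit_interval. (\<lambda>n. h x * of_real (bump a b n x))
          \<longlonglongrightarrow> indicator {a<..<b} x *\<^sub>R h x"
        using bump_tendsto_indicator[of a b]
        by (intro AE_I2) (auto simp: scaleR_conv_of_real mult.commute intro!: tendsto_intros)
      show "AE x in unit_interval. norm (h x * of_real (bump a b n x)) \<le> norm (h x)" for n
        using bump_bounds[of a b n]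
        by (intro AE_I2) (auto simp: norm_mult mult_left_le)
    qed (use h in auto)
    show "(\<lambda>n. LINT x|unit_interval. h x * of_real (bump a b n x)) \<longlonglongrightarrow> 0"
      using zero[OF test_function_bump[OF that]] by simp
  qed
  show ?thesis
  proof (rule LIMSEQ_unique)
    let ?I = "\<lambda>n. {a + inverse (real (Suc n))<..<b - inverse (real (Suc n))}"
    show "(\<lambda>n. LINT x|unit_interval. indicator (?I n) x *\<^sub>R h x)
        \<longlonglongrightarrow> (LINT x|unit_interval. indicator {a<..<b} x *\<^sub>R h x)"
    proof (rule integral_dominated_convergence[where w = "\<lambda>x. norm (h x)"])
      have "(\<lambda>n. indicator (?I n) x *\<^sub>R h x) \<longlonglongrightarrow> indicator {a<..<b} x *\<^sub>R h x" for x
      proof (rule tendsto_eventually)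
        have "(\<lambda>n. a + inverse (real (Suc n))) \<longlonglongrightarrow> a + 0" "(\<lambda>n. b - inverse (real (Suc n))) \<longlonglongrightarrow> b - 0"
          by (intro tendsto_intros LIMSEQ_inverse_real_of_nat)+
        then have ev: "a < x \<Longrightarrow> \<forall>\<^sub>F n in sequentially. a + inverse (real (Suc n)) < x"
            "x < b \<Longrightarrow> \<forall>\<^sub>F n in sequentially. x < b - inverse (real (Suc n))"
          using order_tendstoD by auto
        show "\<forall>\<^sub>F n in sequentially. indicator (?I n) x *\<^sub>R h x = indicator {a<..<b} x *\<^sub>R h x"
        proof (cases "x \<in> {a<..<b}")
          case True
          then have "\<forall>\<^sub>F n in sequentially. a + inverse (real (Suc n)) < x"
            "\<forall>\<^sub>F n in sequentially. x < b - inverse (real (Suc n))"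
            using ev by auto
          then show ?thesis
            by eventually_elim (use True in auto)
        next
          case False
          have "x \<notin> ?I n" for n
          proof
            have "inverse (real (Suc n)) > 0" by simp
            moreover assume "x \<in> ?I n"
            ultimately have "x \<in> {a<..<b}"
              unfolding greaterThanLessThan_iff by linarith
            with False show False ..
          qed
          then show ?thesis using False by simp
        qed
      qed
      then show "AE x in unit_interval. (\<lambda>n. indicator (?I n) x *\<^sub>R h x)
          \<longlonglongrightarrow> indicator {a<..<b} x *\<^sub>R h x" by simp
      show "AE x in unit_interval. norm (indicator (?I n) x *\<^sub>R h x) \<le> norm (h x)" for n
        by (intro AE_I2) (auto split: split_indicator)
    qed (use h in auto)
    have "0 < a + inverse (real (Suc n))" "b - inverse (real (Suc n)) < 1" for n
      using \<open>0 \<le> a\<close> \<open>b \<le> 1\<close> positive_imp_inverse_positive[of "real (Suc n)"] by linarith+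
    then show "(\<lambda>n. LINT x|unit_interval. indicator (?I n) x *\<^sub>R h x) \<longlonglongrightarrow> 0"
      by (simp add: interior)
  qed
qed

text \<open>After extension by 0 to the real line, integrals over rays reduce to integrals over open
  subintervals, and \<open>AE_eq_0_if_integral_greaterThan_0\<close> applies to the real and
  imaginary parts.\<close>

lemma AE_eq_0_if_test_functions_0:
  fixes h :: "real \<Rightarrow> complex"
  assumes h: "integrable unit_interval h"
    and zero: "\<And>\<phi>. test_function \<phi> \<Longrightarrow> (LINT x|unit_interval. h x * of_real (\<phi> x)) = 0"
  shows "AE x in unit_interval. h x = 0"
proof -
  define H where "H x = indicator {0..1} x *\<^sub>R h x" for x :: real
  have H: "integrable lborel H"
    using h by (simp add: H_def[abs_def] integrable_unit_interval)
  have tail: "(LINT x|lborel. indicator {a<..} x *\<^sub>R H x) = 0" for a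
  proof -
    have "(LINT x|lborel. indicator {a<..} x *\<^sub>R H x)
        = (LINT x|lborel. indicator {0..1} x *\<^sub>R (indicator {max a 0<..<1} x *\<^sub>R h x))"
    proof (rule integral_cong_AE)
      have "AE x in lborel. x \<noteq> 0 \<and> x \<noteq> (1::real)"
        using AE_lborel_singleton[of 0] AE_lborel_singleton[of "1::real"] by eventually_elim simp
      then show "AE x in lborel. indicator {a<..} x *\<^sub>R H x
          = indicator {0..1} x *\<^sub>R (indicator {max a 0<..<1} x *\<^sub>R h x)"
        by eventually_elim (auto simp: H_def split: split_indicator)
      have [measurable]: "H \<in> borel_measurable borel"
        using borel_measurable_integrable[OF H] by simp
      show "(\<lambda>x. indicator {a<..} x *\<^sub>R H x) \<in> borel_measurable lborel" by measurable
      have "(\<lambda>x. indicator {0..1} x *\<^sub>R (indicator {max a 0<..<1} x *\<^sub>R h x))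
          = (\<lambda>x. indicator {max a 0<..<1} x *\<^sub>R H x)"
        by (auto simp: H_def split: split_indicator)
      then show "(\<lambda>x. indicator {0..1} x *\<^sub>R (indicator {max a 0<..<1} x *\<^sub>R h x))
          \<in> borel_measurable lborel" by simp
    qed
    also have "\<dots> = (LINT x|unit_interval. indicator {max a 0<..<1} x *\<^sub>R h x)"
      by (simp add: integral_unit_interval)
    also have "\<dots> = 0"
      using integral_open_interval_eq_0[OF h zero] by simp
    finally show ?thesis .
  qed
  have tail_int: "integrable lborel (\<lambda>x. indicator {a<..} x *\<^sub>R H x)" for a
    by (rule integrable_mult_indicator[OF _ H]) simp
  have "AE x in lborel. Re (H x) = 0"
    using integral_Re[OF tail_int] tail
    by (intro AE_eq_0_if_integral_greaterThan_0 integrable_Re H) simp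
  moreover have "AE x in lborel. Im (H x) = 0"
    using integral_Im[OF tail_int] tail
    by (intro AE_eq_0_if_integral_greaterThan_0 integrable_Im H) simp
  ultimately have "AE x in lborel. x \<in> {0..1} \<longrightarrow> h x = 0"
    by eventually_elim (auto simp: H_def complex_eq_iff)
  then show ?thesis
    unfolding unit_interval_def by (subst AE_restrict_space_iff) auto
qed

subsection \<open>Sobolev inner products of polynomials\<close>

lemma test_function_deriv:
  assumes "test_function \<phi>"
  shows "test_function (deriv \<phi>)"
proof -
  obtain a b where ab: "0 < a" "b < 1" "\<And>x. x \<notin> {a..b} \<Longrightarrow> \<phi> x = 0"
    using assms unfolding test_function_def by blast
  have "deriv \<phi> x = 0" if "x \<notin> {a..b}" for x
  proof -
    have "\<forall>\<^sub>F y in nhds x. \<phi> y = 0"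
      by (rule eventually_mono[OF eventually_nhds_in_open[of "- {a..b}" x]])
        (use that ab in \<open>auto simp: open_Compl\<close>)
    from deriv_cong_ev[OF this refl] show ?thesis by simp
  qed
  moreover have "(deriv ^^ k) (deriv \<phi>) differentiable at x" for k x
  proof -
    have "(deriv ^^ Suc k) \<phi> differentiable at x"
      using assms unfolding test_function_def by blast
    then show ?thesis by (simp only: funpow_Suc_right o_apply)
  qed
  ultimately show ?thesis
    using ab unfolding test_function_def by blast
qed

lemma test_function_has_derivative:
  assumes "test_function \<phi>"
  shows "(\<phi> has_real_derivative deriv \<phi> x) (at x)"
proof -
  have "(deriv ^^ 0) \<phi> differentiable at x"
    using assms unfolding test_function_def by blast
  then show ?thesis by (simp add: DERIV_deriv_iff_real_differentiable)
qed

lemma test_function_continuous: "test_function \<phi> \<Longrightarrow> continuous_on S \<phi>"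
  by (rule DERIV_continuous_on[OF has_field_derivative_at_within[OF test_function_has_derivative]])

lemma test_function_endpoints: "test_function \<phi> \<Longrightarrow> \<phi> 0 = 0 \<and> \<phi> 1 = 0"
  unfolding test_function_def by fastforce

lemma continuous_imp_L2:
  fixes f :: "real \<Rightarrow> complex"
  assumes "continuous_on UNIV f"
  shows "f \<in> L2_space unit_interval"
proof -
  have m: "f \<in> borel_measurable unit_interval"
    by (intro measurable_unit_interval borel_measurable_continuous_onI assms)
  have "bounded (f ` {0..1})"
    by (intro compact_imp_bounded compact_continuous_image continuous_on_subset[OF assms]) auto
  then obtain B where B: "\<And>x. x \<in> {0..1} \<Longrightarrow> norm (f x) \<le> B"
    unfolding bounded_iff by blast
  have "integrable unit_interval (\<lambda>x. (cmod (f x))\<^sup>2)"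
  proof (rule unit_interval.integrable_const_bound[where B = "B\<^sup>2"])
    show "AE x in unit_interval. norm ((cmod (f x))\<^sup>2) \<le> B\<^sup>2"
      by (intro AE_I2) (use B in \<open>auto intro!: power_mono\<close>)
  qed (use m in measurable)
  then show ?thesis using m by (simp add: L2_space_def)
qed

lemma L2_imp_integrable:
  assumes "f \<in> L2_space unit_interval"
  shows "integrable unit_interval f"
proof (rule Bochner_Integration.integrable_bound)
  show "integrable unit_interval (\<lambda>x. 1 + (cmod (f x))\<^sup>2)"
    using assms by (auto simp: L2_space_def)
  have "norm (f x) \<le> 1 + (cmod (f x))\<^sup>2" for x
    using zero_le_power2[of "cmod (f x) - 1"] norm_ge_zero[of "f x"] unfolding power2_diff one_power2 by linarith
  then have "norm (f x) \<le> norm (1 + (cmod (f x))\<^sup>2)" for x by simp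
  then show "AE x in unit_interval. norm (f x) \<le> norm (1 + (cmod (f x))\<^sup>2)" by simp
qed (use assms in \<open>auto simp: L2_space_def\<close>)

lemma integrable_L2_times_test_function:
  assumes "f \<in> L2_space unit_interval" and "test_function \<phi>"
  shows "integrable unit_interval (\<lambda>x. f x * complex_of_real (\<phi> x))"
proof -
  have m: "\<phi> \<in> borel_measurable unit_interval"
    by (intro measurable_unit_interval borel_measurable_continuous_onI test_function_continuous assms)
  have "bounded (\<phi> ` {0..1})"
    by (intro compact_imp_bounded compact_continuous_image test_function_continuous assms) auto
  then obtain B where B: "\<And>x. x \<in> {0..1} \<Longrightarrow> norm (\<phi> x) \<le> B"
    unfolding bounded_iff by blast
  show ?thesis
  proof (rule Bochner_Integration.integrable_bound)
    show "integrable unit_interval (\<lambda>x. B * norm (f x))"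
      using L2_imp_integrable[OF assms(1)] by simp
    show "AE x in unit_interval. norm (f x * complex_of_real (\<phi> x)) \<le> norm (B * norm (f x))"
    proof (intro AE_I2)
      fix x assume "x \<in> space unit_interval"
      then have "\<bar>\<phi> x\<bar> \<le> \<bar>B\<bar>" using B[of x] by auto
      then show "norm (f x * complex_of_real (\<phi> x)) \<le> norm (B * norm (f x))"
        by (simp add: norm_mult abs_mult mult.commute[of "cmod (f x)"] mult_right_mono)
    qed
  qed (use assms(1) m in \<open>auto simp: L2_space_def\<close>)
qed

text \<open>Pins down, up to null sets, the representative that \<open>SOME\<close> picks in
  \<open>sobolev_deriv\<close>: the difference of two candidates integrates to 0 against every test
  function.\<close>

lemma weak_deriv_unique:
  assumes "is_weak_deriv l f g" "is_weak_deriv l f g'"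
    and "g \<in> L2_space unit_interval" "g' \<in> L2_space unit_interval"
  shows "AE x in unit_interval. g x = g' x"
proof -
  have "AE x in unit_interval. g x - g' x = 0"
  proof (rule AE_eq_0_if_test_functions_0)
    fix \<phi> assume \<phi>: "test_function \<phi>"
    have "(- 1) ^ l * (LINT x|unit_interval. g x * of_real (\<phi> x))
        = (- 1) ^ l * (LINT x|unit_interval. g' x * of_real (\<phi> x))"
      using assms(1)[unfolded is_weak_deriv_def, rule_format, OF \<phi>]
        assms(2)[unfolded is_weak_deriv_def, rule_format, OF \<phi>] by simp
    then have "(LINT x|unit_interval. g x * of_real (\<phi> x))
        = (LINT x|unit_interval. g' x * of_real (\<phi> x))" by simp
    then show "(LINT x|unit_interval. (g x - g' x) * of_real (\<phi> x)) = 0"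
      using assms(3,4) \<phi> by (simp add: left_diff_distrib integrable_L2_times_test_function)
  qed (use assms(3,4) L2_imp_integrable in auto)
  then show ?thesis by simp
qed

lemma integral_by_parts_test_function:
  fixes F F' :: "real \<Rightarrow> complex"
  assumes F: "\<And>x. (F has_vector_derivative F' x) (at x)" and F': "continuous_on UNIV F'"
    and \<phi>: "test_function \<phi>"
  shows "(LINT x|unit_interval. F x * of_real (deriv \<phi> x)) = - (LINT x|unit_interval. F' x * of_real (\<phi> x))"
proof -
  have contF: "continuous_on UNIV F"
    by (intro continuous_at_imp_continuous_on ballI has_vector_derivative_continuous[OF F])
  have "(LINT x|unit_interval. F x * of_real (deriv \<phi> x) + F' x * of_real (\<phi> x))
      = F 1 * of_real (\<phi> 1) - F 0 * of_real (\<phi> 0)"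
    unfolding integral_unit_interval
  proof (rule integral_FTC_atLeastAtMost)
    fix x :: real
    have "((\<lambda>x. of_real (\<phi> x) :: complex) has_vector_derivative of_real (deriv \<phi> x)) (at x)"
      by (intro has_vector_derivative_of_real test_function_has_derivative \<phi>)
    from has_vector_derivative_mult[OF F this]
    show "((\<lambda>x. F x * of_real (\<phi> x)) has_vector_derivative
        F x * of_real (deriv \<phi> x) + F' x * of_real (\<phi> x)) (at x within {0..1})"
      by (rule has_vector_derivative_at_within)
    show "continuous_on {0..1} (\<lambda>x. F x * of_real (deriv \<phi> x) + F' x * of_real (\<phi> x))"
      by (intro continuous_intros test_function_continuous test_function_deriv \<phi>
          continuous_on_subset[OF contF] continuous_on_subset[OF F']) auto
  qed simp
  also have "\<dots> = 0" using test_function_endpoints[OF \<phi>] by simp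
  finally show ?thesis
    using \<phi> contF F' by (subst (asm) Bochner_Integration.integral_add)
      (auto intro!: integrable_L2_times_test_function continuous_imp_L2 test_function_deriv
        simp: eq_neg_iff_add_eq_0)
qed

section \<open>Derivatives and integrals of polynomials\<close>

abbreviation cpoly :: "real poly \<Rightarrow> real \<Rightarrow> complex" where
  "cpoly p \<equiv> (\<lambda>x. complex_of_real (poly p x))"

lemma cpoly_has_vector_derivative: "(cpoly p has_vector_derivative cpoly (pderiv p) x) (at x within S)"
  by (rule has_vector_derivative_of_real[OF has_field_derivative_at_within[OF poly_DERIV]])

lemma continuous_on_cpoly: "continuous_on S (cpoly p)"
  by (intro continuous_intros)

text \<open>The induction hypothesis is applied with \<open>deriv \<phi>\<close> as test function,
  which leaves a single integration by parts.\<close>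

lemma is_weak_deriv_cpoly: "is_weak_deriv l (cpoly p) (cpoly ((pderiv ^^ l) p))"
proof (induction l)
  case 0
  show ?case by (simp add: is_weak_deriv_def)
next
  case (Suc l)
  show ?case unfolding is_weak_deriv_def
  proof (intro allI impI)
    fix \<phi> assume \<phi>: "test_function \<phi>"
    have "(LINT x|unit_interval. cpoly p x * of_real ((deriv ^^ Suc l) \<phi> x))
        = (LINT x|unit_interval. cpoly p x * of_real ((deriv ^^ l) (deriv \<phi>) x))"
      by (simp only: funpow_Suc_right o_apply)
    also have "\<dots> = (- 1) ^ l * (LINT x|unit_interval. cpoly ((pderiv ^^ l) p) x * of_real (deriv \<phi> x))"
      using Suc test_function_deriv[OF \<phi>] unfolding is_weak_deriv_def by blast
    also have "\<dots> = (- 1) ^ Suc l * (LINT x|unit_interval. cpoly ((pderiv ^^ Suc l) p) x * of_real (\<phi> x))"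
      by (simp add: integral_by_parts_test_function[OF cpoly_has_vector_derivative continuous_on_cpoly \<phi>])
    finally show "(LINT x|unit_interval. cpoly p x * of_real ((deriv ^^ Suc l) \<phi> x))
        = (- 1) ^ Suc l * (LINT x|unit_interval. cpoly ((pderiv ^^ Suc l) p) x * of_real (\<phi> x))" .
  qed
qed

text \<open>Values and derivatives are proved together: the iterate is known only on the unit
  interval, and its derivative within that interval is determined by those values.\<close>

lemma interval_deriv_cpoly:
  "x \<in> {0..1} \<Longrightarrow> (interval_deriv ^^ l) (cpoly p) x = cpoly ((pderiv ^^ l) p) x"
  and interval_deriv_cpoly_has_vector_derivative:
  "x \<in> {0..1} \<Longrightarrow> ((interval_deriv ^^ l) (cpoly p) has_vector_derivative
     cpoly ((pderiv ^^ Suc l) p) x) (at x within {0..1})"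
proof (induction l arbitrary: x)
  case 0
  {
    case 1
    show ?case by simp
  next
    case 2
    show ?case using cpoly_has_vector_derivative by simp
  }
next
  case (Suc l)
  have eq: "(interval_deriv ^^ Suc l) (cpoly p) x = cpoly ((pderiv ^^ Suc l) p) x"
    if "x \<in> {0..1}" for x
    using vector_derivative_within_closed_interval[OF _ that Suc.IH(2)[OF that]]
    by (simp add: interval_deriv_def[of "(interval_deriv ^^ l) (cpoly p)"])
  {
    case 1
    then show ?case by (rule eq)
  next
    case 2
    have "(cpoly ((pderiv ^^ Suc l) p) has_vector_derivative cpoly ((pderiv ^^ Suc (Suc l)) p) x)
        (at x within {0..1})"
      using cpoly_has_vector_derivative by simp
    then show ?case
      by (rule has_vector_derivative_transform[OF 2, rotated]) (rule eq)
  }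
qed

lemma pderiv_funpow_eq_0: "degree p < l \<Longrightarrow> (pderiv ^^ l) p = 0"
  for p :: "real poly"
proof (induction l arbitrary: p)
  case (Suc l)
  then show ?case
  proof (cases "degree p")
    case 0
    then have "pderiv p = 0" by (simp add: pderiv_eq_0_iff)
    moreover have "(pderiv ^^ l) 0 = (0 :: real poly)" by (induction l) auto
    ultimately show ?thesis by (simp only: funpow_Suc_right o_apply)
  next
    case (Suc k)
    then show ?thesis
      using Suc.IH[of "pderiv p"] Suc.prems by (simp only: funpow_Suc_right o_apply degree_pderiv)
  qed
qed simp

lemma cpoly_in_sobolev: "cpoly p \<in> sobolev s"
proof (cases s)
  case (enat r)
  then show ?thesis
    using is_weak_deriv_cpoly continuous_imp_L2[OF continuous_on_cpoly]
    by (auto simp: sobolev_def)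
next
  case infinity
  have "(interval_deriv ^^ k) (cpoly p) differentiable_on {0..1}" for k
    unfolding differentiable_on_def
    by (intro ballI differentiableI_vector) (rule interval_deriv_cpoly_has_vector_derivative)
  moreover have "summable (\<lambda>l. (L2_norm unit_interval ((interval_deriv ^^ l) (cpoly p)))\<^sup>2)"
  proof (rule summable_finite)
    fix l assume "l \<notin> {..degree p}"
    then have "(LINT x|unit_interval. (cmod ((interval_deriv ^^ l) (cpoly p) x))\<^sup>2)
        = (LINT x|unit_interval. 0)"
      by (intro Bochner_Integration.integral_cong)
        (auto simp: interval_deriv_cpoly pderiv_funpow_eq_0)
    then show "(L2_norm unit_interval ((interval_deriv ^^ l) (cpoly p)))\<^sup>2 = 0"
      by (simp add: L2_norm_def)
  qed simp
  ultimately show ?thesis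
    using infinity by (simp add: sobolev_def smooth_on_interval_def)
qed

text \<open>For finite \<open>s\<close> the derivative is an arbitrary choice, so it is identified
  only almost everywhere; measurability is recorded as well because integrals are compared by
  \<open>integral_cong_AE\<close>.\<close>

lemma sobolev_deriv_cpoly:
  "sobolev_deriv s l (cpoly p) \<in> borel_measurable unit_interval"
  "AE x in unit_interval. sobolev_deriv s l (cpoly p) x = cpoly ((pderiv ^^ l) p) x"
proof -
  have L2: "cpoly q \<in> L2_space unit_interval" for q
    by (rule continuous_imp_L2[OF continuous_on_cpoly])
  have "sobolev_deriv s l (cpoly p) \<in> borel_measurable unit_interval \<and>
    (AE x in unit_interval. sobolev_deriv s l (cpoly p) x = cpoly ((pderiv ^^ l) p) x)"
  proof (cases s)
    case (enat r)
    let ?g = "SOME g. g \<in> L2_space unit_interval \<and> is_weak_deriv l (cpoly p) g"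
    have "?g \<in> L2_space unit_interval \<and> is_weak_deriv l (cpoly p) ?g"
      by (rule someI[where x = "cpoly ((pderiv ^^ l) p)"]) (use L2 is_weak_deriv_cpoly in blast)
    then show ?thesis
      using weak_deriv_unique[OF _ is_weak_deriv_cpoly _ L2]
      by (auto simp: enat sobolev_deriv_def L2_space_def)
  next
    case infinity
    have "sobolev_deriv s l (cpoly p) \<in> borel_measurable unit_interval
      \<longleftrightarrow> cpoly ((pderiv ^^ l) p) \<in> borel_measurable unit_interval"
      by (rule measurable_cong) (simp add: infinity sobolev_deriv_def interval_deriv_cpoly)
    then show ?thesis
      using L2 by (auto simp: infinity sobolev_deriv_def interval_deriv_cpoly L2_space_def)
  qed
  then show "sobolev_deriv s l (cpoly p) \<in> borel_measurable unit_interval"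
    "AE x in unit_interval. sobolev_deriv s l (cpoly p) x = cpoly ((pderiv ^^ l) p) x" by auto
qed

lemma L2_inner_sobolev_deriv_cpoly:
  "L2_inner unit_interval (sobolev_deriv s l (cpoly p)) (sobolev_deriv s l (cpoly q))
    = of_real (LINT x|unit_interval. poly ((pderiv ^^ l) p * (pderiv ^^ l) q) x)"
proof -
  have [measurable]: "cpoly q \<in> borel_measurable unit_interval" for q
    using continuous_imp_L2[OF continuous_on_cpoly] by (auto simp: L2_space_def)
  note [measurable] = sobolev_deriv_cpoly(1)
  have "L2_inner unit_interval (sobolev_deriv s l (cpoly p)) (sobolev_deriv s l (cpoly q))
     = (LINT x|unit_interval. cpoly ((pderiv ^^ l) p) x * cpoly ((pderiv ^^ l) q) x)"
    unfolding L2_inner_def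
  proof (rule integral_cong_AE)
    show "AE x in unit_interval. sobolev_deriv s l (cpoly p) x * cnj (sobolev_deriv s l (cpoly q) x)
        = cpoly ((pderiv ^^ l) p) x * cpoly ((pderiv ^^ l) q) x"
      using sobolev_deriv_cpoly(2)[of s l p] sobolev_deriv_cpoly(2)[of s l q] by eventually_elim simp
    have [measurable]: "cnj \<in> borel_measurable borel"
      by (intro borel_measurable_continuous_onI continuous_intros)
    show "(\<lambda>x. sobolev_deriv s l (cpoly p) x * cnj (sobolev_deriv s l (cpoly q) x))
        \<in> borel_measurable unit_interval" by measurable
    show "(\<lambda>x. cpoly ((pderiv ^^ l) p) x * cpoly ((pderiv ^^ l) q) x) \<in> borel_measurable unit_interval"
      by (intro borel_measurable_times) fact+
  qed
  then show ?thesis by (simp flip: of_real_mult)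
qed

text \<open>With a free bound \<open>n\<close> in place of the degree, all products of the
  polynomials used later are integrated by one fixed sum.\<close>

lemma integral_poly:
  assumes "degree p \<le> n"
  shows "(LINT x|unit_interval. poly p x) = (\<Sum>i\<le>n. coeff p i / (real i + 1))"
proof -
  have "(LINT x|unit_interval. poly p x)
      = (\<Sum>i\<le>n. coeff p i * 1 ^ Suc i / (real i + 1)) - (\<Sum>i\<le>n. coeff p i * 0 ^ Suc i / (real i + 1))"
    unfolding integral_unit_interval
  proof (rule integral_FTC_atLeastAtMost)
    fix x :: real
    have "poly p x = (\<Sum>i\<le>n. coeff p i * x ^ i)"
      unfolding poly_altdef using assms
      by (intro sum.mono_neutral_left) (auto simp: coeff_eq_0)
    moreover have "((\<lambda>x. c * x ^ Suc i / (real i + 1)) has_real_derivative c * x ^ i) (at x within {0..1})"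
      for c i
      using DERIV_cmult[OF DERIV_pow[of "Suc i" x "{0..1}"], of "c / (real i + 1)"]
      by (simp add: divide_simps add.commute)
    then have "((\<lambda>x. \<Sum>i\<le>n. coeff p i * x ^ Suc i / (real i + 1)) has_real_derivative
        (\<Sum>i\<le>n. coeff p i * x ^ i)) (at x within {0..1})"
      by (intro DERIV_sum)
    ultimately show "((\<lambda>x. \<Sum>i\<le>n. coeff p i * x ^ Suc i / (real i + 1)) has_vector_derivative
        poly p x) (at x within {0..1})"
      by (simp add: has_real_derivative_iff_has_vector_derivative)
  qed (auto intro!: continuous_intros)
  then show ?thesis by simp
qed

text \<open>Derivatives beyond the degree vanish, so even for \<open>s = \<infinity>\<close> only
  finitely many orders contribute, and finite and infinite smoothness are treated alike.\<close>

lemma sobolev_inner_cpoly: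
  assumes "degree p \<le> n"
  shows "sobolev_inner s (cpoly p) (cpoly q) = of_real (\<Sum>l | l \<le> n \<and> enat l \<le> s.
    LINT x|unit_interval. poly ((pderiv ^^ l) p * (pderiv ^^ l) q) x)"
proof -
  have "sobolev_inner s (cpoly p) (cpoly q) = (\<Sum>\<^sub>\<infinity>l\<in>{l. l \<le> n \<and> enat l \<le> s}.
      of_real (LINT x|unit_interval. poly ((pderiv ^^ l) p * (pderiv ^^ l) q) x))"
    unfolding sobolev_inner_def L2_inner_sobolev_deriv_cpoly
    by (rule infsum_cong_neutral)
      (use assms in \<open>auto simp: pderiv_funpow_eq_0 poly_0[abs_def] simp del: poly_mult\<close>)
  then show ?thesis by simp
qed

subsection \<open>A lower bound from orthogonal systems\<close>

lemma norm_mult_le_squares: "cmod (a * b) \<le> (cmod a)\<^sup>2 + (cmod b)\<^sup>2"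
proof -
  have "cmod a * cmod b \<le> (cmod a)\<^sup>2 + (cmod b)\<^sup>2"
  proof -
    have "0 \<le> (cmod a - cmod b)\<^sup>2 + cmod a * cmod b" by simp
    then show ?thesis by (simp add: power2_diff algebra_simps)
  qed
  then show ?thesis by (simp add: norm_mult)
qed

lemma L2_mult_cnj_integrable:
  assumes "f \<in> L2_space M" "g \<in> L2_space M"
  shows "integrable M (\<lambda>x. f x * cnj (g x))"
proof (rule Bochner_Integration.integrable_bound)
  show "integrable M (\<lambda>x. (cmod (f x))\<^sup>2 + (cmod (g x))\<^sup>2)"
    using assms by (auto simp: L2_space_def)
  have [measurable]: "cnj \<in> borel_measurable borel"
    by (intro borel_measurable_continuous_onI continuous_intros)
  have [measurable]: "f \<in> borel_measurable M" "g \<in> borel_measurable M"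
    using assms by (auto simp: L2_space_def)
  show "(\<lambda>x. f x * cnj (g x)) \<in> borel_measurable M" by measurable
  show "AE x in M. norm (f x * cnj (g x)) \<le> norm ((cmod (f x))\<^sup>2 + (cmod (g x))\<^sup>2)"
    using norm_mult_le_squares[of "f _" "cnj (g _)"] by (intro AE_I2) simp
qed

lemma L2_space_add:
  assumes "f \<in> L2_space M" "g \<in> L2_space M"
  shows "(\<lambda>x. f x + g x) \<in> L2_space M"
proof -
  have [measurable]: "f \<in> borel_measurable M" "g \<in> borel_measurable M"
    using assms by (auto simp: L2_space_def)
  have "integrable M (\<lambda>x. (cmod (f x + g x))\<^sup>2)"
  proof (rule Bochner_Integration.integrable_bound)
    show "integrable M (\<lambda>x. 2 * (cmod (f x))\<^sup>2 + 2 * (cmod (g x))\<^sup>2)"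
      using assms by (auto simp: L2_space_def)
    have "(cmod (f x + g x))\<^sup>2 \<le> 2 * (cmod (f x))\<^sup>2 + 2 * (cmod (g x))\<^sup>2" for x
    proof -
      have "(cmod (f x + g x))\<^sup>2 \<le> (cmod (f x) + cmod (g x))\<^sup>2"
        by (intro power_mono norm_triangle_ineq) simp
      also have "\<dots> \<le> 2 * (cmod (f x))\<^sup>2 + 2 * (cmod (g x))\<^sup>2"
        using zero_le_power2[of "cmod (f x) - cmod (g x)"] unfolding power2_diff power2_sum by linarith
      finally show ?thesis .
    qed
    then show "AE x in M. norm ((cmod (f x + g x))\<^sup>2) \<le> norm (2 * (cmod (f x))\<^sup>2 + 2 * (cmod (g x))\<^sup>2)"
      by (intro AE_I2) simp
  qed measurable
  then show ?thesis by (simp add: L2_space_def)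
qed

lemma L2_space_cmult: "f \<in> L2_space M \<Longrightarrow> (\<lambda>x. c * f x) \<in> L2_space M"
  by (auto simp: L2_space_def norm_mult power_mult_distrib)

lemma L2_space_0: "(\<lambda>x. 0) \<in> L2_space M"
  by (auto simp: L2_space_def)

lemma L2_space_sum: "(\<And>i. i \<in> S \<Longrightarrow> f i \<in> L2_space M) \<Longrightarrow> (\<lambda>x. \<Sum>i\<in>S. f i x) \<in> L2_space M"
  by (induction S rule: infinite_finite_induct) (auto intro: L2_space_add L2_space_0)

lemma L2_space_diff:
  assumes "f \<in> L2_space M" "g \<in> L2_space M"
  shows "(\<lambda>x. f x - g x) \<in> L2_space M"
  using L2_space_add[OF assms(1) L2_space_cmult[OF assms(2), of "-1"]] by simp

lemma L2_norm_eq_0_imp_AE: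
  assumes "L2_norm M f = 0" "f \<in> L2_space M"
  shows "AE x in M. f x = 0"
proof -
  have "(LINT x|M. (cmod (f x))\<^sup>2) = 0"
    using assms(1) by (simp add: L2_norm_def)
  then have "AE x in M. (cmod (f x))\<^sup>2 = 0"
    using assms(2) by (subst (asm) integral_nonneg_eq_0_iff_AE) (auto simp: L2_space_def)
  then show ?thesis by simp
qed

interpretation cube: product_sigma_finite "\<lambda>_::nat. unit_interval"
  by unfold_locales

lemma L2_space_product:
  assumes "\<And>i. i < d \<Longrightarrow> F i \<in> L2_space unit_interval"
  shows "(\<lambda>x. \<Prod>i<d. F i (x i)) \<in> L2_space (unit_cube d)"
proof -
  have "(\<lambda>x. F i (x i)) \<in> borel_measurable (unit_cube d)" if "i < d" for i
  proof -
    have "(\<lambda>x. x i) \<in> measurable (unit_cube d) unit_interval"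
      unfolding unit_cube_def by (rule measurable_component_singleton) (use that in simp)
    moreover have "F i \<in> borel_measurable unit_interval"
      using assms[OF that] by (simp add: L2_space_def)
    ultimately show ?thesis by (rule measurable_compose)
  qed
  moreover have "integrable (unit_cube d) (\<lambda>x. \<Prod>i<d. (cmod (F i (x i)))\<^sup>2)"
    unfolding unit_cube_def using assms
    by (intro cube.product_integrable_prod) (auto simp: L2_space_def)
  ultimately show ?thesis
    by (auto simp: L2_space_def prod_norm[symmetric] prod_power_distrib)
qed

text \<open>Gaussian elimination: a row \<open>v\<close> with nonzero entry in column
  \<open>m\<close> clears that column in the other rows, and the induction hypothesis applies to
  what remains.\<close>

lemma linear_relation_exists:
  fixes c :: "'i \<Rightarrow> nat \<Rightarrow> complex"
  assumes "finite W" "m < card W"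
  shows "\<exists>a. (\<exists>w\<in>W. a w \<noteq> 0) \<and> (\<forall>j<m. (\<Sum>w\<in>W. a w * c w j) = 0)"
  using assms
proof (induction m arbitrary: W c)
  case 0
  then show ?case by (intro exI[of _ "\<lambda>_. 1"]) (auto simp: card_gt_0_iff)
next
  case (Suc m)
  show ?case
  proof (cases "\<forall>w\<in>W. c w m = 0")
    case True
    then show ?thesis
      using Suc.IH[of W c] Suc.prems by (auto simp: less_Suc_eq)
  next
    case False
    then obtain v where v: "v \<in> W" "c v m \<noteq> 0" by blast
    define c' where "c' w j = c w j - c w m / c v m * c v j" for w j
    obtain a where a: "\<exists>w\<in>W - {v}. a w \<noteq> 0" "\<And>j. j < m \<Longrightarrow> (\<Sum>w\<in>W - {v}. a w * c' w j) = 0"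
    proof -
      have "finite (W - {v})" "m < card (W - {v})" using Suc.prems v by auto
      from Suc.IH[OF this, of c'] that show thesis by blast
    qed
    \<comment> \<open>The coefficient of the pivot row is solved from equation \<open>m\<close>; the
      earlier equations then hold by the definition of \<open>c'\<close>.\<close>
    define t where "t = - (\<Sum>w\<in>W - {v}. a w * c w m) / c v m"
    define b where "b = a(v := t)"
    have split: "(\<Sum>w\<in>W. b w * c w j) = t * c v j + (\<Sum>w\<in>W - {v}. a w * c w j)" for j
      using v Suc.prems(1) by (simp add: sum.remove[of W v] b_def)
    have "(\<Sum>w\<in>W. b w * c w j) = 0" if "j < Suc m" for j
    proof (cases "j = m")
      case True
      then show ?thesis using v by (simp add: split t_def)
    next
      case False
      have "(\<Sum>w\<in>W - {v}. a w * c' w j)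
          = (\<Sum>w\<in>W - {v}. a w * c w j) - (\<Sum>w\<in>W - {v}. a w * c w m) / c v m * c v j"
        by (simp add: c'_def right_diff_distrib sum_subtractf sum_distrib_right sum_divide_distrib mult.assoc)
      then show ?thesis using a(2)[of j] that False by (simp add: split t_def)
    qed
    moreover have "\<exists>w\<in>W. b w \<noteq> 0" using a(1) by (auto simp: b_def)
    ultimately show ?thesis by blast
  qed
qed

text \<open>Lists are not reduced, so \<open>tensor_diff xs xs\<close> is a list of twice the length
  that vanishes only inside the inner product. This makes constant sequences Cauchy.\<close>

lemma tensor_inner_diff_self: "tensor_inner s d (tensor_diff xs xs) ys = 0"
proof -
  let ?g = "\<lambda>(c, F). \<Sum>(c', G)\<leftarrow>ys. c * cnj c' * (\<Prod>i<d. sobolev_inner s (F i) (G i))"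
  have g: "?g ((\<lambda>(c, F). (- c, F)) p) = - ?g p" for p
    by (cases p) (simp add: split_def uminus_sum_list_map o_def)
  have neg: "sum_list (map (\<lambda>p. - h p) xs) = - sum_list (map h xs)" for h :: "_ \<Rightarrow> complex"
    by (induction xs) auto
  show ?thesis
    unfolding tensor_inner_def tensor_diff_def map_append sum_list_append map_map o_def g neg
    by simp
qed

lemma represents_const:
  assumes "xs \<in> algebraic_tensors s d"
  shows "represents s d (\<lambda>_. xs) (tensor_fun d xs)"
  using assms
  by (auto simp: represents_def tensor_Cauchy_def tensor_norm_def tensor_inner_diff_self L2_norm_def)

text \<open>The constant sequence competes in the infimum. The upper bound is what places a
  normalised combination in the unit ball.\<close>

lemma sobolev_mix_norm_le:
  assumes "xs \<in> algebraic_tensors s d"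
  shows "sobolev_mix_norm s d (tensor_fun d xs) \<le> tensor_norm s d xs"
  unfolding sobolev_mix_norm_def
proof (rule cInf_lower)
  show "tensor_norm s d xs \<in> {r. \<exists>X. represents s d X (tensor_fun d xs) \<and> (\<lambda>k. tensor_norm s d (X k)) \<longlonglongrightarrow> r}"
    using represents_const[OF assms] by (auto intro!: exI[of _ "\<lambda>_. xs"])
  have "0 \<le> r" if "(\<lambda>k. tensor_norm s d (X k)) \<longlonglongrightarrow> r" for r X
    by (rule LIMSEQ_le_const[OF that]) (auto simp: tensor_norm_def)
  then show "bdd_below {r. \<exists>X. represents s d X (tensor_fun d xs) \<and> (\<lambda>k. tensor_norm s d (X k)) \<longlonglongrightarrow> r}"
    by (intro bdd_belowI[of _ 0]) auto
qed

text \<open>One family orthogonal for both inner products; \<open>\<omega>\<close> and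
  \<open>\<nu>\<close> are its squared norms in \<open>sobolev s\<close> and in
  \<open>L2_space\<close>.\<close>

locale orthogonal_system =
  fixes s :: enat and I :: "nat set" and f :: "nat \<Rightarrow> real \<Rightarrow> complex" and \<omega> \<nu> :: "nat \<Rightarrow> real"
  assumes f_sobolev: "i \<in> I \<Longrightarrow> f i \<in> sobolev s"
    and f_L2: "i \<in> I \<Longrightarrow> f i \<in> L2_space unit_interval"
    and sobolev_inner_f: "i \<in> I \<Longrightarrow> j \<in> I \<Longrightarrow>
      sobolev_inner s (f i) (f j) = of_real (if i = j then \<omega> i else 0)"
    and L2_inner_f: "i \<in> I \<Longrightarrow> j \<in> I \<Longrightarrow>
      L2_inner unit_interval (f i) (f j) = of_real (if i = j then \<nu> i else 0)"
    and \<omega>_pos: "i \<in> I \<Longrightarrow> \<omega> i > 0"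
begin

definition comb :: "nat \<Rightarrow> (nat \<Rightarrow> nat) set \<Rightarrow> ((nat \<Rightarrow> nat) \<Rightarrow> complex) \<Rightarrow> (nat \<Rightarrow> real) \<Rightarrow> complex" where
  "comb d W a x = (\<Sum>w\<in>W. a w * (\<Prod>i<d. f (w i) (x i)))"

text \<open>Words are extensional, so distinct ones differ at a coordinate below \<open>d\<close>,
  where the factor is 0.\<close>

lemma prod_delta:
  fixes w w' :: "nat \<Rightarrow> nat"
  assumes "w \<in> {..<d} \<rightarrow>\<^sub>E I" "w' \<in> {..<d} \<rightarrow>\<^sub>E I"
  shows "(\<Prod>i<d. complex_of_real (if w i = w' i then g (w i) else 0))
    = (if w = w' then of_real (\<Prod>i<d. g (w i)) else 0)"
proof (cases "w = w'")
  case False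
  then obtain i where "i < d" "w i \<noteq> w' i"
    using PiE_ext[OF assms] by blast
  then have "(\<Prod>i<d. complex_of_real (if w i = w' i then g (w i) else 0)) = 0"
    by (intro prod_zero) auto
  then show ?thesis using False by simp
qed simp

lemma comb_L2:
  assumes "W \<subseteq> {..<d} \<rightarrow>\<^sub>E I"
  shows "comb d W a \<in> L2_space (unit_cube d)"
  unfolding comb_def[abs_def]
  by (intro L2_space_sum L2_space_cmult L2_space_product f_L2) (use assms in auto)

text \<open>Pythagoras: by Fubini the inner product of two products factorises over the coordinates,
  so distinct words are orthogonal.\<close>

lemma L2_norm_comb:
  assumes W: "W \<subseteq> {..<d} \<rightarrow>\<^sub>E I" "finite W"
  shows "(L2_norm (unit_cube d) (comb d W a))\<^sup>2 = (\<Sum>w\<in>W. (cmod (a w))\<^sup>2 * (\<Prod>i<d. \<nu> (w i)))"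
proof -
  let ?e = "\<lambda>w x. \<Prod>i<d. f (w i) (x i)"
  have int: "integrable (unit_cube d) (\<lambda>x. ?e w x * cnj (?e w' x))"
    if "w \<in> W" "w' \<in> W" for w w'
    by (intro L2_mult_cnj_integrable L2_space_product f_L2) (use W that in auto)
  have val: "(LINT x|unit_cube d. ?e w x * cnj (?e w' x))
      = (if w = w' then of_real (\<Prod>i<d. \<nu> (w i)) else 0)" if "w \<in> W" "w' \<in> W" for w w'
  proof -
    have in_I: "w i \<in> I" "w' i \<in> I" if "i < d" for i
      using W \<open>w \<in> W\<close> \<open>w' \<in> W\<close> that by auto
    have "(LINT x|unit_cube d. ?e w x * cnj (?e w' x))
        = (LINT x|unit_cube d. (\<Prod>i<d. f (w i) (x i) * cnj (f (w' i) (x i))))"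
      by (simp add: prod.distrib)
    also have "\<dots> = (\<Prod>i<d. L2_inner unit_interval (f (w i)) (f (w' i)))"
      unfolding unit_cube_def L2_inner_def
      by (rule cube.product_integral_prod) (auto intro: L2_mult_cnj_integrable f_L2 in_I)
    also have "\<dots> = (\<Prod>i<d. of_real (if w i = w' i then \<nu> (w i) else 0))"
      by (intro prod.cong refl) (simp add: L2_inner_f in_I)
    also have "\<dots> = (if w = w' then of_real (\<Prod>i<d. \<nu> (w i)) else 0)"
      by (rule prod_delta) (use W that in auto)
    finally show ?thesis .
  qed
  have "complex_of_real ((L2_norm (unit_cube d) (comb d W a))\<^sup>2)
      = (LINT x|unit_cube d. of_real ((cmod (comb d W a x))\<^sup>2))"
    by (simp add: L2_norm_def del: of_real_power)
  also have "\<dots> = (LINT x|unit_cube d. (\<Sum>w\<in>W. \<Sum>w'\<in>W. a w * cnj (a w') * (?e w x * cnj (?e w' x))))"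
    by (intro Bochner_Integration.integral_cong refl)
      (simp only: complex_norm_square comb_def cnj_sum sum_product complex_cnj_mult ac_simps)
  also have "\<dots> = (\<Sum>w\<in>W. \<Sum>w'\<in>W. a w * cnj (a w') * (if w = w' then of_real (\<Prod>i<d. \<nu> (w i)) else 0))"
    using int val by simp
  also have "\<dots> = (\<Sum>w\<in>W. a w * cnj (a w) * of_real (\<Prod>i<d. \<nu> (w i)))"
    using W(2) by (simp add: if_distrib[of "\<lambda>z. _ * z"] cong: if_cong)
  also have "\<dots> = of_real (\<Sum>w\<in>W. (cmod (a w))\<^sup>2 * (\<Prod>i<d. \<nu> (w i)))"
    by (simp only: of_real_sum of_real_mult complex_norm_square)
  finally show ?thesis by (simp only: of_real_eq_iff)
qed

text \<open>A combination is the function of a finite tensor, whose norm is given by the same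
  Pythagoras computation with \<open>\<omega>\<close>.\<close>

lemma comb_sobolev_mix:
  assumes W: "W \<subseteq> {..<d} \<rightarrow>\<^sub>E I" "finite W"
  shows "comb d W a \<in> sobolev_mix s d"
    and "(sobolev_mix_norm s d (comb d W a)) \<le> sqrt (\<Sum>w\<in>W. (cmod (a w))\<^sup>2 * (\<Prod>i<d. \<omega> (w i)))"
proof -
  \<comment> \<open>Enumerating without repetition turns the list sums of the tensor into sums over
    \<open>W\<close>.\<close>
  obtain ws where ws: "set ws = W" "distinct ws"
    using finite_distinct_list[OF W(2)] by blast
  define xs where "xs = map (\<lambda>w. (a w, \<lambda>i. f (w i))) ws"
  have alg: "xs \<in> algebraic_tensors s d"
    using W ws by (auto simp: xs_def algebraic_tensors_def intro!: f_sobolev)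
  have fn: "tensor_fun d xs = comb d W a"
    by (rule ext) (simp add: tensor_fun_def xs_def o_def comb_def ws sum_list_distinct_conv_sum_set)
  then show "comb d W a \<in> sobolev_mix s d"
    using represents_const[OF alg] comb_L2[OF W(1)] by (auto simp: sobolev_mix_def)
  have pos: "0 \<le> (\<Sum>w\<in>W. (cmod (a w))\<^sup>2 * (\<Prod>i<d. \<omega> (w i)))"
    using W by (intro sum_nonneg mult_nonneg_nonneg prod_nonneg ballI less_imp_le[OF \<omega>_pos]) auto
  have "tensor_inner s d xs xs
      = (\<Sum>w\<in>W. \<Sum>w'\<in>W. a w * cnj (a w') * (\<Prod>i<d. sobolev_inner s (f (w i)) (f (w' i))))"
    by (simp add: tensor_inner_def xs_def o_def ws sum_list_distinct_conv_sum_set)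
  also have "\<dots> = (\<Sum>w\<in>W. \<Sum>w'\<in>W. a w * cnj (a w') * (if w = w' then of_real (\<Prod>i<d. \<omega> (w i)) else 0))"
  proof (intro sum.cong refl arg_cong2[where f = "(*)"])
    fix w w' assume "w \<in> W" "w' \<in> W"
    then have in_W: "w \<in> {..<d} \<rightarrow>\<^sub>E I" "w' \<in> {..<d} \<rightarrow>\<^sub>E I" using W by auto
    have "(\<Prod>i<d. sobolev_inner s (f (w i)) (f (w' i)))
        = (\<Prod>i<d. of_real (if w i = w' i then \<omega> (w i) else 0))"
      by (intro prod.cong refl sobolev_inner_f) (use in_W in auto)
    then show "(\<Prod>i<d. sobolev_inner s (f (w i)) (f (w' i)))
        = (if w = w' then of_real (\<Prod>i<d. \<omega> (w i)) else 0)"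
      using prod_delta[OF in_W] by simp
  qed
  also have "\<dots> = (\<Sum>w\<in>W. a w * cnj (a w) * of_real (\<Prod>i<d. \<omega> (w i)))"
    using W(2) by (simp add: if_distrib[of "\<lambda>z. _ * z"] cong: if_cong)
  also have "\<dots> = of_real (\<Sum>w\<in>W. (cmod (a w))\<^sup>2 * (\<Prod>i<d. \<omega> (w i)))"
    by (simp only: of_real_sum of_real_mult complex_norm_square)
  finally have "tensor_norm s d xs = sqrt (\<Sum>w\<in>W. (cmod (a w))\<^sup>2 * (\<Prod>i<d. \<omega> (w i)))"
    using pos by (simp only: tensor_norm_def norm_of_real abs_of_nonneg)
  then show "(sobolev_mix_norm s d (comb d W a)) \<le> sqrt (\<Sum>w\<in>W. (cmod (a w))\<^sup>2 * (\<Prod>i<d. \<omega> (w i)))"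
    using sobolev_mix_norm_le[OF alg] fn by simp
qed

text \<open>Linearity of \<open>A\<close> holds only up to functions of seminorm zero, here almost
  everywhere; the induction collects finitely many null sets.\<close>

lemma operator_comb:
  assumes A: "bounded_operator (sobolev_mix s d) nX (L2_space (unit_cube d)) (L2_norm (unit_cube d)) A"
    and W: "W \<subseteq> {..<d} \<rightarrow>\<^sub>E I" "finite W"
  shows "AE y in unit_cube d. A (comb d W a) y = (\<Sum>w\<in>W. a w * A (comb d {w} (\<lambda>_. 1)) y)"
  using W(2,1)
proof (induction W rule: finite_induct)
  have A_L2: "A g \<in> L2_space (unit_cube d)" if "g \<in> sobolev_mix s d" for g
    using A that by (simp add: bounded_operator_def)
  have smult: "AE y in unit_cube d. A (\<lambda>x. c * g x) y - c * A g y = 0"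
    if "g \<in> sobolev_mix s d" "(\<lambda>x. c * g x) \<in> sobolev_mix s d" for c g
    using A that
    by (intro L2_norm_eq_0_imp_AE L2_space_diff L2_space_cmult A_L2) (auto simp: bounded_operator_def)
  have add: "AE y in unit_cube d. A (\<lambda>x. g x + h x) y - (A g y + A h y) = 0"
    if "g \<in> sobolev_mix s d" "h \<in> sobolev_mix s d" "(\<lambda>x. g x + h x) \<in> sobolev_mix s d" for g h
    using A that
    by (intro L2_norm_eq_0_imp_AE L2_space_diff L2_space_add A_L2) (auto simp: bounded_operator_def)
  {
    case empty
    \<comment> \<open>The empty combination is the zero function, and homogeneity at the scalar 0
      shows that its image is null.\<close>
    have "comb d {} a = (\<lambda>_. 0)" by (simp add: comb_def[abs_def])
    then show ?case
      using smult[of "\<lambda>_. 0" 0] comb_sobolev_mix(1)[of "{}" d a] by simp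
  next
    case (insert w W)
    have single: "(\<lambda>x. a w * comb d {w} (\<lambda>_. 1) x) = comb d {w} a"
      by (simp add: comb_def[abs_def])
    have ins: "(\<lambda>x. comb d {w} a x + comb d W a x) = comb d (insert w W) a"
      using insert.hyps by (simp add: comb_def[abs_def])
    have mem: "comb d (insert w W) a \<in> sobolev_mix s d" "comb d W a \<in> sobolev_mix s d"
      "comb d {w} a \<in> sobolev_mix s d" "comb d {w} (\<lambda>_. 1) \<in> sobolev_mix s d"
      using insert.prems insert.hyps by (auto intro!: comb_sobolev_mix(1))
    have "AE y in unit_cube d. A (comb d {w} a) y - a w * A (comb d {w} (\<lambda>_. 1)) y = 0"
      using smult[of "comb d {w} (\<lambda>_. 1)" "a w"] mem by (simp add: single)
    moreover have "AE y in unit_cube d. A (comb d (insert w W) a) y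
        - (A (comb d {w} a) y + A (comb d W a) y) = 0"
      using add[of "comb d {w} a" "comb d W a"] mem by (simp add: single ins)
    moreover have "AE y in unit_cube d. A (comb d W a) y = (\<Sum>w\<in>W. a w * A (comb d {w} (\<lambda>_. 1)) y)"
      using insert by simp
    ultimately show ?case
      by eventually_elim (use insert.hyps in \<open>simp add: algebra_simps\<close>)
  }
qed

text \<open>Some unit vector \<open>u\<close> of the span is killed by \<open>A\<close> almost
  everywhere, so \<open>u - A u\<close> has the \<open>L2_norm\<close> of \<open>u\<close>. By
  orthogonality the condition on single words passes to \<open>u\<close>.\<close>

theorem approx_number_ge:
  assumes W: "W \<subseteq> {..<d} \<rightarrow>\<^sub>E I" "finite W" "n \<le> card W"
    and ratio: "\<And>w. w \<in> W \<Longrightarrow> \<epsilon>\<^sup>2 * (\<Prod>i<d. \<omega> (w i)) \<le> (\<Prod>i<d. \<nu> (w i))"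
    and "\<epsilon> \<ge> 0"
  shows "ereal \<epsilon> \<le> sobolev_mix_approx_number n s d"
  unfolding sobolev_mix_approx_number_def approx_number_def
proof (rule INF_greatest)
  let ?Y = "L2_space (unit_cube d)" and ?nY = "L2_norm (unit_cube d)" and ?X = "sobolev_mix s d"
  fix A assume "A \<in> {A. bounded_operator ?X (sobolev_mix_norm s d) ?Y ?nY A
      \<and> operator_rank ?X ?nY A < enat n}"
  then have A: "bounded_operator ?X (sobolev_mix_norm s d) ?Y ?nY A"
    and rank: "operator_rank ?X ?nY A < enat n" by auto
  have A_L2: "A g \<in> ?Y" if "g \<in> ?X" for g
    using A that by (simp add: bounded_operator_def)
  obtain m b where m: "m < n" and b: "\<forall>j<m. b j \<in> A ` ?X"
    and span: "\<forall>g\<in>?X. \<exists>c. ?nY (\<lambda>y. A g y - (\<Sum>j<m. c j * b j y)) = 0"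
    using rank unfolding operator_rank_def Inf_less_iff by auto
  have b_L2: "b j \<in> ?Y" if "j < m" for j
    using b that A_L2 by auto
  define e where "e w = comb d {w} (\<lambda>_. 1)" for w
  have e: "e w \<in> ?X" if "w \<in> W" for w
    unfolding e_def using W that by (intro comb_sobolev_mix) auto
  have "\<forall>w\<in>W. \<exists>c. ?nY (\<lambda>y. A (e w) y - (\<Sum>j<m. c j * b j y)) = 0"
    using span e by blast
  from bchoice[OF this] obtain c
    where c: "\<And>w. w \<in> W \<Longrightarrow> ?nY (\<lambda>y. A (e w) y - (\<Sum>j<m. c w j * b j y)) = 0"
    by blast
  have c_AE: "AE y in unit_cube d. A (e w) y - (\<Sum>j<m. c w j * b j y) = 0" if "w \<in> W" for w
    using that by (intro L2_norm_eq_0_imp_AE c L2_space_diff L2_space_sum L2_space_cmult A_L2 e b_L2) auto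
  \<comment> \<open>There are more words than functions \<open>b j\<close>, so the coefficient
    vectors of the images \<open>A (e w)\<close> are linearly dependent.\<close>
  obtain a0 where a0: "\<exists>w\<in>W. a0 w \<noteq> 0" "\<And>j. j < m \<Longrightarrow> (\<Sum>w\<in>W. a0 w * c w j) = 0"
    using linear_relation_exists[of W m c] W m by auto
  define N where "N = (\<Sum>w\<in>W. (cmod (a0 w))\<^sup>2 * (\<Prod>i<d. \<omega> (w i)))"
  have \<omega>_prod: "(\<Prod>i<d. \<omega> (w i)) > 0" if "w \<in> W" for w
    using W that by (intro prod_pos \<omega>_pos ballI) auto
  obtain v where v: "v \<in> W" "a0 v \<noteq> 0" using a0(1) by blast
  have "N > 0"
    unfolding N_def
  proof (rule sum_pos2[OF W(2) v(1)])
    show "w \<in> W \<Longrightarrow> 0 \<le> (cmod (a0 w))\<^sup>2 * (\<Prod>i<d. \<omega> (w i))" for w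
      using \<omega>_prod[of w] by simp
    show "0 < (cmod (a0 v))\<^sup>2 * (\<Prod>i<d. \<omega> (v i))"
      using v \<omega>_prod by simp
  qed
  \<comment> \<open>Scaled so that the bound for the mixed norm becomes exactly 1.\<close>
  define a where "a w = a0 w / of_real (sqrt N)" for w
  have a: "(\<Sum>w\<in>W. a w * c w j) = 0" if "j < m" for j
    using a0(2)[OF that] by (simp add: a_def flip: sum_divide_distrib)
  have a_norm: "(\<Sum>w\<in>W. (cmod (a w))\<^sup>2 * (\<Prod>i<d. \<omega> (w i))) = 1"
    using \<open>N > 0\<close> by (simp add: a_def norm_divide power_divide N_def[symmetric] flip: sum_divide_distrib)
  define u where "u = comb d W a"
  have u: "u \<in> ?X" "sobolev_mix_norm s d u \<le> 1"
    using comb_sobolev_mix[OF W(1,2), of a] a_norm by (auto simp: u_def)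
  have "AE y in unit_cube d. \<forall>w\<in>W. A (e w) y - (\<Sum>j<m. c w j * b j y) = 0"
    using W(2) c_AE by (simp add: AE_finite_all)
  moreover have "AE y in unit_cube d. A u y = (\<Sum>w\<in>W. a w * A (e w) y)"
    unfolding u_def e_def by (rule operator_comb[OF A W(1,2)])
  ultimately have Au: "AE y in unit_cube d. A u y = 0"
  proof eventually_elim
    case (elim y)
    then have "A u y = (\<Sum>w\<in>W. a w * (\<Sum>j<m. c w j * b j y))" by simp
    also have "\<dots> = (\<Sum>j<m. (\<Sum>w\<in>W. a w * c w j) * b j y)"
      unfolding sum_distrib_left sum_distrib_right by (subst sum.swap) (simp add: ac_simps)
    also have "\<dots> = 0" by (simp add: a)
    finally show ?case .
  qed
  have u_L2: "u \<in> ?Y" and diff_L2: "(\<lambda>y. u y - A u y) \<in> ?Y"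
    using comb_L2[OF W(1)] A_L2[OF u(1)] by (auto simp: u_def intro: L2_space_diff)
  have "?nY (\<lambda>y. u y - A u y) = ?nY u"
    unfolding L2_norm_def
  proof (intro arg_cong[where f = sqrt] integral_cong_AE)
    show "AE y in unit_cube d. (cmod (u y - A u y))\<^sup>2 = (cmod (u y))\<^sup>2"
      using Au by eventually_elim simp
  qed (use u_L2 diff_L2 in \<open>auto simp: L2_space_def\<close>)
  moreover have "\<epsilon>\<^sup>2 \<le> (?nY u)\<^sup>2"
  proof -
    have "\<epsilon>\<^sup>2 = (\<Sum>w\<in>W. (cmod (a w))\<^sup>2 * (\<epsilon>\<^sup>2 * (\<Prod>i<d. \<omega> (w i))))"
      using a_norm by (simp add: mult.left_commute[of _ "\<epsilon>\<^sup>2"] flip: sum_distrib_left)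
    also have "\<dots> \<le> (\<Sum>w\<in>W. (cmod (a w))\<^sup>2 * (\<Prod>i<d. \<nu> (w i)))"
      by (intro sum_mono mult_left_mono ratio) auto
    finally show ?thesis by (simp add: u_def L2_norm_comb[OF W(1,2)])
  qed
  ultimately have "\<epsilon> \<le> ?nY (\<lambda>y. u y - A u y)"
    using power2_le_imp_le[of \<epsilon> "?nY u"] by (simp add: L2_norm_def)
  then have "ereal \<epsilon> \<le> ereal (?nY (\<lambda>y. u y - A u y))" by simp
  also have "\<dots> \<le> operator_norm ?X (sobolev_mix_norm s d) ?nY (\<lambda>g y. g y - A g y)"
    unfolding operator_norm_def by (rule SUP_upper) (use u in simp)
  finally show "ereal \<epsilon> \<le> operator_norm ?X (sobolev_mix_norm s d) ?nY (\<lambda>g y. g y - A g y)" .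
qed

end

subsection \<open>Products of Legendre polynomials\<close>

text \<open>Multiples of the shifted Legendre polynomials of degree at most \<open>2\<close>.\<close>

definition leg :: "nat \<Rightarrow> real poly" where
  "leg i = (if i = 0 then [:1:] else if i = 1 then [:-1/2, 1:] else [:1/6, -1, 1:])"

text \<open>The squared norms in \<open>L2_space\<close>.\<close>

definition leg_norm :: "nat \<Rightarrow> real" where
  "leg_norm i = (if i = 0 then 1 else if i = 1 then 1/12 else 1/180)"

text \<open>The worst squared ratios over all \<open>s\<close>. The quadratic one is attained for
  \<open>s \<ge> 2\<close>: with squared norms 1/180, 1/3 and 4 of its derivatives, the quotient is
  1/(1 + 60 + 720).\<close>

definition leg_ratio :: "nat \<Rightarrow> real" where
  "leg_ratio i = (if i = 0 then 1 else if i = 1 then 1/13 else 1/781)"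

lemma integral_leg:
  assumes "i \<in> {..2}" "j \<in> {..2}"
  shows "(LINT x|unit_interval. poly (leg i * leg j) x) = (if i = j then leg_norm i else 0)"
    and "(LINT x|unit_interval. poly (pderiv (leg i) * pderiv (leg j)) x)
      = (if i = j then if i = 0 then 0 else if i = 1 then 1 else 1/3 else 0)"
    and "(LINT x|unit_interval. poly (pderiv (pderiv (leg i)) * pderiv (pderiv (leg j))) x)
      = (if i = j \<and> i = 2 then 4 else 0)"
proof -
  have ij: "i = 0 \<or> i = 1 \<or> i = 2" "j = 0 \<or> j = 1 \<or> j = 2" using assms by auto
  have sum4: "(\<Sum>l\<le>4. g l) = g 0 + g 1 + g 2 + g 3 + g 4" for g :: "nat \<Rightarrow> real"
    by (simp add: eval_nat_numeral)
  have deg: "degree (leg i) \<le> 2" for i by (simp add: leg_def)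
  have deg': "degree (pderiv (leg i)) \<le> 2" "degree (pderiv (pderiv (leg i))) \<le> 2" for i
    using deg[of i] by (auto simp: degree_pderiv)
  have deg_mult: "degree (p * q) \<le> 4" if "degree p \<le> 2" "degree q \<le> 2" for p q :: "real poly"
    using degree_mult_le[of p q] that by linarith
  note coeffs = leg_def leg_norm_def pderiv_pCons coeff_pCons numeral_eq_Suc
  show "(LINT x|unit_interval. poly (leg i * leg j) x) = (if i = j then leg_norm i else 0)"
    unfolding integral_poly[OF deg_mult[OF deg deg]] sum4
    using ij by (elim disjE) (simp_all add: coeffs)
  show "(LINT x|unit_interval. poly (pderiv (leg i) * pderiv (leg j)) x)
      = (if i = j then if i = 0 then 0 else if i = 1 then 1 else 1/3 else 0)"
    unfolding integral_poly[OF deg_mult[OF deg'(1) deg'(1)]] sum4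
    using ij by (elim disjE) (simp_all add: coeffs)
  show "(LINT x|unit_interval. poly (pderiv (pderiv (leg i)) * pderiv (pderiv (leg j))) x)
      = (if i = j \<and> i = 2 then 4 else 0)"
    unfolding integral_poly[OF deg_mult[OF deg'(2) deg'(2)]] sum4
    using ij by (elim disjE) (simp_all add: coeffs)
qed

text \<open>The derivatives of these three polynomials are again pairwise orthogonal in every order,
  so the sum over the orders stays diagonal.\<close>

lemma orthogonal_system_leg:
  assumes "s \<ge> 1"
  obtains \<omega> where "orthogonal_system s {..2} (\<lambda>i. cpoly (leg i)) \<omega> leg_norm"
    and "\<And>i. i \<in> {..2} \<Longrightarrow> leg_ratio i * \<omega> i \<le> leg_norm i"
proof
  \<comment> \<open>The second derivative of the quadratic is the constant 2; it contributes 4, and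
    only if \<open>s \<ge> 2\<close>.\<close>
  define t :: real where "t = (if enat 2 \<le> s then 4 else 0)"
  define \<omega> where "\<omega> i = (if i = 0 then 1 else if i = 1 then 13/12 else 61/180 + t)" for i :: nat
  have "enat 0 \<le> s" "enat 1 \<le> s"
    using assms by (simp_all add: zero_enat_def[symmetric] one_enat_def[symmetric] del: One_nat_def)
  then have "{l. l \<le> 2 \<and> enat l \<le> s} = (if enat 2 \<le> s then {0, 1, 2} else {0, 1})"
    by (auto simp: le_Suc_eq numeral_2_eq_2)
  then have sum: "(\<Sum>l | l \<le> 2 \<and> enat l \<le> s. g l) = g 0 + g 1 + (if enat 2 \<le> s then g 2 else 0)"
    for g :: "nat \<Rightarrow> real"
    by simp
  show "orthogonal_system s {..2} (\<lambda>i. cpoly (leg i)) \<omega> leg_norm"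
  proof
    fix i j :: nat assume ij: "i \<in> {..2}" "j \<in> {..2}"
    show "cpoly (leg i) \<in> sobolev s" by (rule cpoly_in_sobolev)
    show "cpoly (leg i) \<in> L2_space unit_interval"
      by (rule continuous_imp_L2[OF continuous_on_cpoly])
    have "degree (leg i) \<le> 2" by (simp add: leg_def)
    then have "sobolev_inner s (cpoly (leg i)) (cpoly (leg j))
      = of_real (\<Sum>l | l \<le> 2 \<and> enat l \<le> s.
          LINT x|unit_interval. poly ((pderiv ^^ l) (leg i) * (pderiv ^^ l) (leg j)) x)"
      by (rule sobolev_inner_cpoly)
    also have "\<dots> = of_real (if i = j then \<omega> i else 0)"
      unfolding sum using ij
      by (simp add: integral_leg numeral_2_eq_2 \<omega>_def t_def leg_norm_def del: poly_mult)
    finally show "sobolev_inner s (cpoly (leg i)) (cpoly (leg j)) = of_real (if i = j then \<omega> i else 0)" .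
    have "L2_inner unit_interval (cpoly (leg i)) (cpoly (leg j))
        = of_real (LINT x|unit_interval. poly (leg i * leg j) x)"
      unfolding L2_inner_def by (simp flip: of_real_mult)
    then show "L2_inner unit_interval (cpoly (leg i)) (cpoly (leg j)) = of_real (if i = j then leg_norm i else 0)"
      using ij by (simp add: integral_leg del: poly_mult)
    show "0 < \<omega> i" by (simp add: \<omega>_def t_def)
  qed
  show "leg_ratio i * \<omega> i \<le> leg_norm i" if "i \<in> {..2}" for i
    by (simp add: leg_ratio_def \<omega>_def leg_norm_def t_def)
qed

text \<open>Replacing the exact quotients by \<open>leg_ratio\<close> removes \<open>s\<close> and
  leaves pure counting of words.\<close>

lemma approx_number_ge_words:
  assumes "s \<ge> 1" and W: "W \<subseteq> {..<d} \<rightarrow>\<^sub>E {..2}" "n \<le> card W"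
    and ratio: "\<And>w. w \<in> W \<Longrightarrow> \<epsilon>\<^sup>2 \<le> (\<Prod>i<d. leg_ratio (w i))" and "\<epsilon> \<ge> 0"
  shows "ereal \<epsilon> \<le> sobolev_mix_approx_number n s d"
proof -
  obtain \<omega> where os: "orthogonal_system s {..2} (\<lambda>i. cpoly (leg i)) \<omega> leg_norm"
    and le: "\<And>i. i \<in> {..2} \<Longrightarrow> leg_ratio i * \<omega> i \<le> leg_norm i"
    by (rule orthogonal_system_leg[OF \<open>s \<ge> 1\<close>]) blast
  interpret orthogonal_system s "{..2}" "\<lambda>i. cpoly (leg i)" \<omega> leg_norm by (rule os)
  have "finite W"
    by (rule finite_subset[OF W(1)]) (intro finite_PiE; simp)
  then show ?thesis
  proof (rule approx_number_ge[OF W(1) _ W(2) _ \<open>\<epsilon> \<ge> 0\<close>])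
    fix w assume "w \<in> W"
    then have w: "w i \<in> {..2}" if "i < d" for i using W that by auto
    have "\<epsilon>\<^sup>2 * (\<Prod>i<d. \<omega> (w i)) \<le> (\<Prod>i<d. leg_ratio (w i)) * (\<Prod>i<d. \<omega> (w i))"
      using w by (intro mult_right_mono ratio \<open>w \<in> W\<close> prod_nonneg) (auto intro: less_imp_le \<omega>_pos)
    also have "\<dots> \<le> (\<Prod>i<d. leg_norm (w i))"
      unfolding prod.distrib[symmetric]
      using w by (intro prod_mono conjI le mult_nonneg_nonneg) (auto simp: leg_ratio_def intro: less_imp_le \<omega>_pos)
    finally show "\<epsilon>\<^sup>2 * (\<Prod>i<d. \<omega> (w i)) \<le> (\<Prod>i<d. leg_norm (w i))" .
  qed
qed

text \<open>\<open>T\<close> holds the positions of the linear factors and \<open>U\<close> those of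
  the quadratic ones; the restriction makes the word extensional.\<close>

definition word :: "nat \<Rightarrow> nat set \<Rightarrow> nat set \<Rightarrow> nat \<Rightarrow> nat" where
  "word d T U = (\<lambda>i\<in>{..<d}. if i \<in> U then 2 else if i \<in> T then 1 else 0)"

lemma word_in_PiE: "word d T U \<in> {..<d} \<rightarrow>\<^sub>E {..2}"
  by (auto simp: word_def)

lemma word_eqD:
  assumes "word d T U = word d T' U'"
    and "T \<subseteq> {..<d} - U" "T' \<subseteq> {..<d} - U'" "U \<subseteq> {..<d}" "U' \<subseteq> {..<d}"
  shows "T = T' \<and> U = U'"
proof -
  have "T = {i\<in>{..<d}. word d T U i = 1}" "U = {i\<in>{..<d}. word d T U i = 2}"
    if "T \<subseteq> {..<d} - U" "U \<subseteq> {..<d}" for T U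
    using that by (auto simp: word_def)
  then show ?thesis using assms by metis
qed

lemma prod_leg_ratio_word:
  assumes "T \<subseteq> {..<d} - U" "U \<subseteq> {..<d}"
  shows "(\<Prod>i<d. leg_ratio (word d T U i)) = (1/13) ^ card T * (1/781) ^ card U"
proof -
  have fin: "finite T" "finite U" using assms by (auto intro: finite_subset)
  have "(\<Prod>i<d. leg_ratio (word d T U i)) = (\<Prod>i\<in>T \<union> U. leg_ratio (word d T U i))"
    using assms by (intro prod.mono_neutral_right) (auto simp: word_def leg_ratio_def)
  also have "\<dots> = (\<Prod>i\<in>T. leg_ratio (word d T U i)) * (\<Prod>i\<in>U. leg_ratio (word d T U i))"
    using assms fin by (intro prod.union_disjoint) auto
  also have "(\<Prod>i\<in>T. leg_ratio (word d T U i)) = (\<Prod>i\<in>T. 1/13)"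
    using assms by (intro prod.cong) (auto simp: word_def leg_ratio_def)
  also have "(\<Prod>i\<in>U. leg_ratio (word d T U i)) = (\<Prod>i\<in>U. 1/781)"
    using assms by (intro prod.cong) (auto simp: word_def leg_ratio_def)
  finally show ?thesis by simp
qed

definition binsum :: "nat \<Rightarrow> nat \<Rightarrow> nat" where
  "binsum d k = (\<Sum>j\<le>k. d choose j)"

lemma card_small_subsets:
  assumes "finite A"
  shows "card {T. T \<subseteq> A \<and> card T \<le> k} = binsum (card A) k"
proof -
  have "{T. T \<subseteq> A \<and> card T \<le> k} = (\<Union>j\<le>k. {T. T \<subseteq> A \<and> card T = j})" by auto
  also have "card \<dots> = (\<Sum>j\<le>k. card {T. T \<subseteq> A \<and> card T = j})"
    using assms by (intro card_UN_disjoint) auto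
  also have "\<dots> = binsum (card A) k"
    using assms by (simp add: binsum_def n_subsets)
  finally show ?thesis .
qed

text \<open>No quadratic factor in \<open>words1\<close>, exactly one in \<open>words2\<close>;
  together they suffice for every \<open>n\<close> up to \<open>2 ^ d\<close>.\<close>

definition words1 :: "nat \<Rightarrow> nat \<Rightarrow> (nat \<Rightarrow> nat) set" where
  "words1 d k = (\<lambda>T. word d T {}) ` {T. T \<subseteq> {..<d} \<and> card T \<le> k}"

definition words2 :: "nat \<Rightarrow> nat \<Rightarrow> (nat \<Rightarrow> nat) set" where
  "words2 d k = (\<lambda>(i, T). word d T {i}) ` (SIGMA i:{..<d}. {T. T \<subseteq> {..<d} - {i} \<and> card T \<le> k})"

lemma card_words1: "card (words1 d k) = binsum d k"
proof -
  have "inj_on (\<lambda>T. word d T {}) {T. T \<subseteq> {..<d} \<and> card T \<le> k}"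
    by (rule inj_onI) (use word_eqD[of d _ "{}" _ "{}"] in auto)
  then show ?thesis
    unfolding words1_def by (simp add: card_image card_small_subsets)
qed

lemma card_words2: "card (words2 d k) = d * binsum (d - 1) k"
proof -
  have "inj_on (\<lambda>(i, T). word d T {i}) (SIGMA i:{..<d}. {T. T \<subseteq> {..<d} - {i} \<and> card T \<le> k})"
  proof (rule inj_onI)
    fix p q
    assume *: "p \<in> (SIGMA i:{..<d}. {T. T \<subseteq> {..<d} - {i} \<and> card T \<le> k})"
      "q \<in> (SIGMA i:{..<d}. {T. T \<subseteq> {..<d} - {i} \<and> card T \<le> k})"
      "(\<lambda>(i, T). word d T {i}) p = (\<lambda>(i, T). word d T {i}) q"
    obtain i T j T' where "p = (i, T)" "q = (j, T')" by (cases p, cases q)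
    then show "p = q" using * word_eqD[of d T "{i}" T' "{j}"] by auto
  qed
  moreover have "card {T. T \<subseteq> {..<d} - {i} \<and> card T \<le> k} = binsum (d - 1) k" if "i < d" for i
    using that card_small_subsets[of "{..<d} - {i}" k] by simp
  ultimately show ?thesis
    unfolding words2_def by (simp add: card_image card_SigmaI)
qed

lemma approx_number_ge_binsum:
  assumes "s \<ge> 1" "\<epsilon> \<ge> 0" and n: "n \<le> binsum d k" and \<epsilon>: "\<epsilon>\<^sup>2 \<le> (1/13) ^ k"
  shows "ereal \<epsilon> \<le> sobolev_mix_approx_number n s d"
proof (rule approx_number_ge_words[OF assms(1)])
  show "words1 d k \<subseteq> {..<d} \<rightarrow>\<^sub>E {..2}"
    using word_in_PiE by (auto simp: words1_def)
  show "n \<le> card (words1 d k)"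
    using n by (simp add: card_words1)
  show "\<epsilon>\<^sup>2 \<le> (\<Prod>i<d. leg_ratio (w i))" if w: "w \<in> words1 d k" for w
  proof -
    obtain T where T: "w = word d T {}" "T \<subseteq> {..<d}" "card T \<le> k"
      using w by (auto simp: words1_def)
    have "\<epsilon>\<^sup>2 \<le> (1/13) ^ card T"
      by (rule order_trans[OF \<epsilon> power_decreasing]) (use T in auto)
    then show ?thesis
      using T prod_leg_ratio_word[of T d "{}"] by simp
  qed
qed fact

text \<open>The two families are disjoint, as only the second has a quadratic factor, so their
  cardinalities add up.\<close>

lemma approx_number_ge_binsum2:
  assumes "s \<ge> 1" "\<epsilon> \<ge> 0" and n: "n \<le> binsum d k + d * binsum (d - 1) l"
    and \<epsilon>: "\<epsilon>\<^sup>2 \<le> (1/13) ^ k" "\<epsilon>\<^sup>2 \<le> (1/13) ^ l / 781"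
  shows "ereal \<epsilon> \<le> sobolev_mix_approx_number n s d"
proof (rule approx_number_ge_words[OF assms(1)])
  show sub: "words1 d k \<union> words2 d l \<subseteq> {..<d} \<rightarrow>\<^sub>E {..2}"
    using word_in_PiE by (auto simp: words1_def words2_def)
  have "finite ({..<d} \<rightarrow>\<^sub>E {..2::nat})" by (intro finite_PiE) auto
  then have fin: "finite (words1 d k)" "finite (words2 d l)"
    using sub by (auto intro: finite_subset)
  have "words1 d k \<inter> words2 d l = {}"
    using word_eqD[where U = "{}"] by (fastforce simp: words1_def words2_def)
  then show "n \<le> card (words1 d k \<union> words2 d l)"
    using n fin by (simp add: card_Un_disjoint card_words1 card_words2)
  fix w assume "w \<in> words1 d k \<union> words2 d l"
  then consider T where "w = word d T {}" "T \<subseteq> {..<d}" "card T \<le> k"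
    | i T where "w = word d T {i}" "i < d" "T \<subseteq> {..<d} - {i}" "card T \<le> l"
    by (auto simp: words1_def words2_def)
  then show "\<epsilon>\<^sup>2 \<le> (\<Prod>i<d. leg_ratio (w i))"
  proof cases
    case 1
    have "\<epsilon>\<^sup>2 \<le> (1/13) ^ card T"
      by (rule order_trans[OF \<epsilon>(1) power_decreasing]) (use 1 in auto)
    then show ?thesis
      using 1 prod_leg_ratio_word[of T d "{}"] by simp
  next
    case 2
    have "(1/13 :: real) ^ l / 781 \<le> (1/13) ^ card T / 781"
      by (intro divide_right_mono power_decreasing) (use 2 in auto)
    then have "\<epsilon>\<^sup>2 \<le> (1/13) ^ card T / 781"
      using \<epsilon>(2) by linarith
    then show ?thesis
      using 2 prod_leg_ratio_word[of T d "{i}"] by simp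
  qed
qed fact

subsection \<open>Partial sums of binomial coefficients\<close>

lemma binsum_mono: "k \<le> l \<Longrightarrow> binsum d k \<le> binsum d l"
  unfolding binsum_def by (rule sum_mono2) auto

lemma binsum_self: "binsum d d = 2 ^ d"
  by (simp add: binsum_def choose_row_sum)

lemma binsum_Suc: "binsum d (Suc k) = binsum d k + (d choose Suc k)"
  by (simp add: binsum_def)

lemma Suc_times_choose_Suc: "Suc k * (n choose Suc k) = (n - k) * (n choose k)"
proof (cases n)
  case (Suc m)
  then show ?thesis
    using Suc_times_binomial[of k m] binomial_absorb_comp[of n k] by simp
qed simp

text \<open>A rule for evaluation: it descends along a row of Pascal's triangle without branching
  and, with \<open>binsum_numeral\<close>, lets the simplifier compute partial sums.\<close>

lemma choose_numeral:
  "n choose numeral w = (n choose pred_numeral w) * (n - pred_numeral w) div numeral w"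
proof -
  have "numeral w * (n choose numeral w) = (n choose pred_numeral w) * (n - pred_numeral w)"
    using Suc_times_choose_Suc[of "pred_numeral w" n] by (simp add: numeral_eq_Suc mult.commute)
  then show ?thesis
    by (metis nonzero_mult_div_cancel_left zero_neq_numeral)
qed

lemma binsum_numeral: "binsum n (numeral w) = binsum n (pred_numeral w) + (n choose numeral w)"
  by (simp add: numeral_eq_Suc binsum_Suc)

lemma binsum_0: "binsum n 0 = 1" and binsum_1: "binsum n (Suc 0) = 1 + n"
  by (simp_all add: binsum_def)

lemmas binsum_eval = binsum_numeral binsum_0 binsum_1 choose_numeral

text \<open>The reflection \<open>j \<mapsto> d - j\<close> maps the indices above \<open>k\<close>
  into those up to \<open>k\<close>.\<close>

lemma two_power_le_binsum:
  assumes "d \<le> 2 * k + 1"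
  shows "2 ^ d \<le> 2 * binsum d k"
proof (cases "k \<le> d")
  case True
  have "2 ^ d = (\<Sum>j\<le>d. d choose j)" by (simp add: choose_row_sum)
  also have "\<dots> = binsum d k + (\<Sum>j\<in>{k<..d}. d choose j)"
    unfolding binsum_def using True by (subst sum.union_disjoint[symmetric]) (auto intro: sum.cong)
  also have "(\<Sum>j\<in>{k<..d}. d choose j) = (\<Sum>j\<in>(\<lambda>i. d - i) ` {k<..d}. d choose j)"
    by (subst sum.reindex) (auto simp: inj_on_def intro!: sum.cong binomial_symmetric)
  also have "\<dots> \<le> binsum d k"
    unfolding binsum_def using assms by (intro sum_mono2) auto
  finally show ?thesis by simp
next
  case False
  then show ?thesis using binsum_mono[of d k d] by (simp add: binsum_self)
qed

text \<open>Termwise comparison in the binomial expansion, using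
  \<open>(k - i) / k \<le> (d - i) / d\<close> for each factor.\<close>

lemma binsum_ge_power:
  assumes "1 \<le> k" "k \<le> d"
  shows "(1 + real d / real k) ^ k \<le> real (binsum d k)"
proof -
  have le: "(k choose j) * d ^ j \<le> (d choose j) * k ^ j" for j
  proof (induction j)
    case (Suc j)
    have "k * d - j * d \<le> k * d - j * k"
      using assms by (intro diff_le_mono2 mult_le_mono2)
    then have "(k - j) * d \<le> (d - j) * k"
      by (simp add: diff_mult_distrib mult.commute[of d k])
    then have "(k - j) * d * ((k choose j) * d ^ j) \<le> (d - j) * k * ((d choose j) * k ^ j)"
      using Suc.IH by (rule mult_le_mono)
    then have "Suc j * (k choose Suc j) * d ^ Suc j \<le> Suc j * (d choose Suc j) * k ^ Suc j"
      unfolding Suc_times_choose_Suc by (simp add: ac_simps)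
    then have "Suc j * ((k choose Suc j) * d ^ Suc j) \<le> Suc j * ((d choose Suc j) * k ^ Suc j)"
      by (simp only: mult.assoc)
    then show ?case by (simp only: mult_le_cancel1)
  qed simp
  have "(1 + real d / real k) ^ k = (\<Sum>j\<le>k. real (k choose j) * (real d / real k) ^ j)"
    using binomial_ring[of "real d / real k" 1 k] by (simp add: add.commute)
  also have "\<dots> \<le> (\<Sum>j\<le>k. real (d choose j))"
  proof (rule sum_mono)
    fix j
    have "real (k choose j) * real d ^ j \<le> real (d choose j) * real k ^ j"
      using le[of j] by (simp flip: of_nat_mult of_nat_power)
    then show "real (k choose j) * (real d / real k) ^ j \<le> real (d choose j)"
      using assms by (simp add: power_divide divide_simps)
  qed
  finally show ?thesis by (simp add: binsum_def)
qed

text \<open>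
  The ratio is smallest at \<open>j\<close> near \<open>d/3\<close>, where it tends to \<open>27/4\<close>; this is the inequality
  \<open>27 u y\<^sup>2 \<le> 4 (u + y)\<^sup>3\<close>. The constant only has to exceed \<open>(71/21)\<^bsup>3/2\<^esup>\<close>.
\<close>

lemma choose_growth:
  assumes "18 \<le> d" "j \<le> d"
  shows "6217/1000 * real (d choose j) \<le> real (d + 3 choose (j + 1))"
proof -
  \<comment> \<open>In these variables the quotient of the two binomial coefficients is
    \<open>(d + 3) * (d + 2) * (d + 1) / (u * (x + 2) * (x + 1))\<close>.\<close>
  define x where "x = real d - real j"
  define u where "u = real j + 1"
  have x: "x \<ge> 0" "u \<ge> 1" using assms(2) by (auto simp: x_def u_def)
  have d: "real d = x + u - 1" by (simp add: x_def u_def)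
  have "6217/1000 * (u * (x + 2) * (x + 1)) \<le> (real d + 3) * (real d + 2) * (real d + 1)"
  proof -
    \<comment> \<open>The midpoint of \<open>x + 1\<close> and \<open>x + 2\<close>, whose square
      exceeds their product by 1/4. The identity below is the weighted inequality of means with its
      remainder made explicit.\<close>
    define y where "y = x + 3/2"
    have "27 * u * y\<^sup>2 + (2 * u - y)\<^sup>2 * (u + 4 * y) = 4 * (u + y) ^ 3"
      by (simp add: power2_eq_square power3_eq_cube algebra_simps)
    moreover have "0 \<le> (2 * u - y)\<^sup>2 * (u + 4 * y)"
      using x by (intro mult_nonneg_nonneg) (auto simp: y_def)
    ultimately have "27 * u * y\<^sup>2 \<le> 4 * (u + y) ^ 3" by linarith
    moreover have "u * ((x + 2) * (x + 1)) \<le> u * y\<^sup>2"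
      using x by (intro mult_left_mono) (auto simp: y_def power2_eq_square algebra_simps)
    ultimately have 1: "27 * (u * (x + 2) * (x + 1)) \<le> 4 * (u + y) ^ 3"
      by (simp add: mult.assoc)
    \<comment> \<open>After this shift the difference of the two cubics has only nonnegative
      coefficients.\<close>
    define t where "t = real d - 18"
    have t: "t \<ge> 0" "real d = t + 18" using assms(1) by (auto simp: t_def)
    have uy: "u + y = t + 41/2" using t(2) d by (simp add: y_def)
    have "6217/1000 * 4 * (t + 41/2) ^ 3 \<le> 27 * ((t + 21) * (t + 20) * (t + 19))"
    proof -
      have "27 * ((t + 21) * (t + 20) * (t + 19)) - 6217/1000 * 4 * (t + 41/2) ^ 3
        = (27 - 6217/250) * t^3 + (27 * 60 - 6217/250 * (123/2)) * t^2
          + (27 * 1199 - 6217/250 * (5043/4)) * t + (27 * 7980 - 6217/250 * (68921/8))"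
        by (simp add: power2_eq_square power3_eq_cube field_simps)
      also have "\<dots> \<ge> 0" using t(1) by (intro add_nonneg_nonneg mult_nonneg_nonneg) auto
      finally show ?thesis by simp
    qed
    then show ?thesis using 1 unfolding uy t(2) by (simp add: algebra_simps)
  qed
  moreover have "real (d + 3 choose (j + 1)) * (u * (x + 2) * (x + 1))
      = real (d choose j) * ((real d + 3) * (real d + 2) * (real d + 1))"
  proof -
    have "d + 3 - (j + 1) = Suc (Suc (d - j))" "real (d - j) = x"
      using assms(2) by (simp_all add: x_def)
    then have F: "fact (d + 3 - (j + 1)) = (x + 2) * (x + 1) * fact (d - j)"
      by (simp only: fact_Suc) (simp add: algebra_simps)
    have G: "fact (d + 3) = (real d + 3) * (real d + 2) * (real d + 1) * fact d" "fact (j + 1) = u * fact j"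
      by (simp_all add: numeral_3_eq_3 u_def algebra_simps)
    have "real (d choose j) = fact d / (fact j * fact (d - j))"
      by (rule binomial_fact) fact
    moreover have "real (d + 3 choose (j + 1))
      = (real d + 3) * (real d + 2) * (real d + 1) * fact d / (u * fact j * ((x + 2) * (x + 1) * fact (d - j)))"
      unfolding F[symmetric] G[symmetric] by (rule binomial_fact) (use assms(2) in simp)
    moreover have "q * a / (u * b * ((x + 2) * (x + 1) * c)) * (u * (x + 2) * (x + 1)) = a / (b * c) * q"
      if "b \<noteq> 0" "c \<noteq> 0" for a b c q :: real
      using that x by (simp add: divide_simps)
    ultimately show ?thesis
      by (simp only: fact_nonzero not_False_eq_True)
  qed
  ultimately have "6217/1000 * (u * (x + 2) * (x + 1)) * real (d choose j)
      \<le> real (d + 3 choose (j + 1)) * (u * (x + 2) * (x + 1))"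
    using mult_right_mono[of "6217/1000 * (u * (x + 2) * (x + 1))" _ "real (d choose j)"]
    by (metis mult.commute of_nat_0_le_iff)
  then have "6217/1000 * real (d choose j) * (u * (x + 2) * (x + 1))
      \<le> real (d + 3 choose (j + 1)) * (u * (x + 2) * (x + 1))"
    by (simp only: ac_simps)
  moreover have "u * (x + 2) * (x + 1) > 0" using x by simp
  ultimately show ?thesis by (rule mult_right_le_imp_le)
qed

text \<open>Raising \<open>d\<close> by 3 and \<open>k\<close> by 1 is the step that keeps
  \<open>k\<close> at \<open>d div 3 + 1\<close>.\<close>

lemma binsum_growth:
  assumes "18 \<le> d" "k \<le> d"
  shows "6217/1000 * real (binsum d k) \<le> real (binsum (d + 3) (k + 1))"
proof -
  have "6217/1000 * real (binsum d k) = (\<Sum>j\<le>k. 6217/1000 * real (d choose j))"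
    by (simp add: binsum_def sum_distrib_left)
  also have "\<dots> \<le> (\<Sum>j\<le>k. real (d + 3 choose (j + 1)))"
    using assms by (intro sum_mono choose_growth) auto
  also have "\<dots> \<le> real (binsum (d + 3) (k + 1))"
    by (simp add: binsum_def sum.atMost_Suc_shift del: sum.atMost_Suc)
  finally show ?thesis .
qed

text \<open>
  Writing \<open>S\<close> for the partial sum, the second inequality is \<open>log\<^sub>2 S \<ge> 0.84 d\<close>, which makes
  \<open>1 + 2d / log\<^sub>2 n \<le> 71/21\<close> for \<open>n \<ge> S\<close>; the first one then bounds its powers up to \<open>d/2 - 1\<close>.
\<close>

lemma binsum_third_ge:
  assumes "12 \<le> d"
  shows "(71/21) ^ (d - 2) \<le> (real (binsum d (d div 3 + 1)))\<^sup>2 \<and>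
    2 ^ (21 * d) \<le> (real (binsum d (d div 3 + 1))) ^ 25"
  using assms
proof (induction d rule: less_induct)
  case (less d)
  show ?case
  proof (cases "d \<le> 20")
    case True
    \<comment> \<open>The growth bound starts at 18 and the induction steps by 3, so all values up
      to 20 are evaluated.\<close>
    then have "d \<in> {12, 13, 14, 15, 16, 17, 18, 19, 20}" using less.prems by auto
    then show ?thesis
      by (elim insertE emptyE) (simp_all add: binsum_eval power_divide)
  next
    case False
    define e where "e = d - 3"
    have e: "d = e + 3" "18 \<le> e" "e < d" using False by (auto simp: e_def)
    let ?S = "real (binsum e (e div 3 + 1))"
    have IH: "(71/21) ^ (e - 2) \<le> ?S\<^sup>2" "2 ^ (21 * e) \<le> ?S ^ 25"
      using less.IH[of e] e by auto
    have step: "6217/1000 * ?S \<le> real (binsum d (d div 3 + 1))"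
      using binsum_growth[of e "e div 3 + 1"] e by simp
    \<comment> \<open>The exponents grow by 3 and 63, and the growth factor pays for both:
      \<open>(71/21)^3 \<le> 6.217^2\<close> and \<open>2^63 \<le> 6.217^25\<close>.\<close>
    have exps: "d - 2 = 3 + (e - 2)" "21 * d = 63 + 21 * e" using e by auto
    have "(71/21) ^ (d - 2) \<le> (6217/1000)\<^sup>2 * ?S\<^sup>2"
      unfolding exps power_add by (intro mult_mono IH) (auto simp: power_divide)
    also have "\<dots> \<le> (real (binsum d (d div 3 + 1)))\<^sup>2"
      unfolding power_mult_distrib[symmetric] by (intro power_mono step) auto
    finally have 1: "(71/21) ^ (d - 2) \<le> (real (binsum d (d div 3 + 1)))\<^sup>2" .
    have "2 ^ (21 * d) \<le> (6217/1000) ^ 25 * ?S ^ 25"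
      unfolding exps power_add by (intro mult_mono IH) (auto simp: power_divide)
    also have "\<dots> \<le> (real (binsum d (d div 3 + 1))) ^ 25"
      unfolding power_mult_distrib[symmetric] by (intro power_mono step) auto
    finally show ?thesis using 1 by simp
  qed
qed

subsection \<open>The number of factors\<close>

text \<open>The integer inequality \<open>2 ^ p \<le> n ^ q\<close> certifies
  \<open>log 2 n \<ge> p / q\<close> and so replaces the logarithm by a fraction.\<close>

lemma log_base_power_le:
  assumes "0 < p" "0 < q" "2 ^ p \<le> n ^ q"
    and "(1 + 2 * real d * real q / real p) ^ k \<le> real n"
  shows "(1 + 2 * real d / log 2 (real n)) ^ k \<le> real n"
proof -
  have "0 < n"
  proof (rule ccontr)
    assume "\<not> 0 < n"
    then show False using assms(2,3) by (simp add: zero_power)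
  qed
  have "real p = log 2 (2 ^ p)" by simp
  also have "\<dots> \<le> log 2 (real n ^ q)"
    using \<open>0 < n\<close> assms(3) by (subst log_le_cancel_iff) (simp_all flip: of_nat_power add: numeral_power_le_of_nat_cancel_iff)
  also have "\<dots> = real q * log 2 (real n)"
    using \<open>0 < n\<close> by (simp add: log_nat_power)
  finally have L: "real p / real q \<le> log 2 (real n)"
    using assms by (simp add: divide_simps mult.commute)
  then have "2 * real d / log 2 (real n) \<le> 2 * real d / (real p / real q)"
    using assms by (intro divide_left_mono mult_pos_pos) (auto intro: less_le_trans[OF _ L])
  then have "(1 + 2 * real d / log 2 (real n)) ^ k \<le> (1 + 2 * real d * real q / real p) ^ k"
    using assms less_le_trans[OF _ L, of 0] by (intro power_mono) auto
  then show ?thesis using assms by linarith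
qed

text \<open>The words of cost at most \<open>k\<close> when a linear factor costs 1 and a quadratic
  one, used at most once, costs 3. The case distinction guards the truncated
  \<open>k - 3\<close>.\<close>

definition count_words :: "nat \<Rightarrow> nat \<Rightarrow> nat" where
  "count_words d k = binsum d k + (if k < 3 then 0 else d * binsum (d - 1) (k - 3))"

text \<open>The exponent is \<open>k - 1\<close> because the constant 0.27 absorbs one factor
  1/13.\<close>

definition admissible :: "nat \<Rightarrow> nat \<Rightarrow> nat \<Rightarrow> bool" where
  "admissible d n k \<longleftrightarrow> n \<le> count_words d k \<and> 1 \<le> k \<and>
     (1 + 2 * real d / log 2 (real n)) ^ (k - 1) \<le> real n"

lemma admissibleI:
  assumes "n \<le> count_words d k" "1 \<le> k" "2 ^ p \<le> n ^ q" "0 < p" "0 < q"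
    and "(1 + 2 * real d * real q / real p) ^ (k - 1) \<le> real n"
  shows "\<exists>k. admissible d n k"
  using assms log_base_power_le unfolding admissible_def by blast

text \<open>From \<open>n > (1 + d / k) ^ k \<ge> 4 ^ k\<close> one gets
  \<open>log 2 n \<ge> 2 k\<close>, so the base is at most \<open>1 + d / k\<close>, whose
  \<open>k\<close>-th power is known to be below \<open>n\<close>.\<close>

lemma admissible_if_sparse:
  assumes "binsum d k < n" "n \<le> binsum d (k + 1)" "3 * k \<le> d"
  shows "admissible d n (k + 1)"
proof (cases "k = 0")
  case True
  then show ?thesis using assms by (simp add: admissible_def count_words_def binsum_eval)
next
  case False
  have "(1 + real d / real k) ^ k \<le> real (binsum d k)"
    using False assms by (intro binsum_ge_power) auto
  then have *: "(1 + real d / real k) ^ k \<le> real n" using assms(1) by linarith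
  have "(4::real) ^ k \<le> (1 + real d / real k) ^ k"
    using False assms(3) by (intro power_mono) (auto simp: divide_simps)
  then have "(4::real) ^ k \<le> real n" using * by linarith
  then have "2 ^ (2 * k) \<le> n ^ 1"
    by (simp add: power_mult numeral_power_le_of_nat_cancel_iff)
  from log_base_power_le[OF _ _ this, where d = d and k = k] show ?thesis
    using False assms(2) * by (simp add: admissible_def count_words_def)
qed

text \<open>Here \<open>k\<close> lies between \<open>d / 3\<close> and \<open>d / 2 - 1\<close>.
  For \<open>d \<ge> 12\<close> the partial sum at \<open>d div 3 + 1\<close> both forces the base
  down to 71/21 and dominates its \<open>k\<close>-th power.\<close>

lemma admissible_if_half:
  assumes "binsum d k < n" "n \<le> binsum d (k + 1)" "d < 3 * k" "n \<le> 2 ^ (d - 1)"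
  shows "\<exists>k. admissible d n k"
proof -
  have k: "2 * k + 2 \<le> d"
  proof (rule ccontr)
    assume "\<not> 2 * k + 2 \<le> d"
    then have "2 ^ d \<le> 2 * binsum d k" by (intro two_power_le_binsum) simp
    also have "\<dots> < 2 * 2 ^ (d - 1)" using assms by simp
    also have "\<dots> = 2 ^ d"
      using assms(1,4) binsum_mono[of 0 k d] by (cases d) (auto simp: binsum_eval)
    finally show False by simp
  qed
  have "binsum d (d div 3 + 1) \<le> binsum d k" using assms(3) by (intro binsum_mono) simp
  then have n: "binsum d (d div 3 + 1) < n" using assms(1) by simp
  have count: "n \<le> count_words d (k + 1)" using assms(2) by (simp add: count_words_def)
  show ?thesis
  proof (cases "d < 12")
    case True
    \<comment> \<open>The only pairs below 12 with \<open>d < 3 * k\<close> and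
      \<open>2 * k + 2 \<le> d\<close>; an integer lower bound for \<open>log 2 n\<close> settles
      each.\<close>
    then have "(d = 8 \<and> k = 3) \<or> (d = 10 \<and> k = 4) \<or> (d = 11 \<and> k = 4)"
      using k assms(3) by presburger
    then show ?thesis
    proof (elim disjE conjE)
      assume "d = 8" "k = 3"
      moreover have "2 ^ 6 \<le> n ^ 1" using n calculation by (simp add: binsum_eval)
      ultimately show ?thesis
        using n by (intro admissibleI[OF count, of 6 1]) (simp_all add: binsum_eval power_divide)
    next
      assume "d = 10" "k = 4"
      moreover have "2 ^ 8 \<le> n ^ 1" using n calculation by (simp add: binsum_eval)
      ultimately show ?thesis
        using n by (intro admissibleI[OF count, of 8 1]) (simp_all add: binsum_eval power_divide)
    next
      assume "d = 11" "k = 4"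
      moreover have "2 ^ 9 \<le> n ^ 1" using n calculation by (simp add: binsum_eval)
      ultimately show ?thesis
        using n by (intro admissibleI[OF count, of 9 1]) (simp_all add: binsum_eval power_divide)
    qed
  next
    case False
    let ?S = "binsum d (d div 3 + 1)"
    have S: "(71/21) ^ (d - 2) \<le> (real ?S)\<^sup>2" "2 ^ (21 * d) \<le> (real ?S) ^ 25"
      using binsum_third_ge[of d] False by auto
    have "2 ^ (21 * d) \<le> ?S ^ 25"
      using S(2) by (simp add: numeral_power_le_of_nat_cancel_iff flip: of_nat_power)
    also have "\<dots> \<le> n ^ 25" using n by (intro power_mono) auto
    finally have le: "2 ^ (21 * d) \<le> n ^ 25" .
    have "((71/21 :: real) ^ k)\<^sup>2 = (71/21) ^ (2 * k)" by (simp flip: power_mult add: mult.commute)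
    also have "\<dots> \<le> (71/21) ^ (d - 2)" using k by (intro power_increasing) auto
    also have "\<dots> \<le> (real ?S)\<^sup>2" by (rule S)
    finally have "(71/21 :: real) ^ k \<le> real ?S" by (rule power2_le_imp_le) simp
    then have "(71/21 :: real) ^ k \<le> real n" using n by linarith
    moreover have "1 + 2 * real d * real 25 / real (21 * d) = 71/21"
      using False by (simp add: divide_simps)
    ultimately have "(1 + 2 * real d * real 25 / real (21 * d)) ^ (k + 1 - 1) \<le> real n"
      by (simp only: add_diff_cancel_right')
    then show ?thesis
      using False by (intro admissibleI[OF count _ le]) auto
  qed
qed

text \<open>The middle coefficient is at most twice its predecessor, so dropping it loses at most
  two thirds of a sum that is at least half of \<open>2 ^ e\<close>.\<close>

lemma binsum_below_half:
  assumes "2 \<le> m" "e = 2 * m \<or> e = 2 * m + 1"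
  shows "2 ^ e \<le> 6 * binsum e (m - 1)"
proof -
  obtain r where r: "m = Suc r" using assms(1) by (cases m) auto
  have "m * (e choose m) = (e - r) * (e choose r)"
    unfolding r by (rule Suc_times_choose_Suc)
  moreover have "(e - r) * (e choose r) \<le> (m + 2) * (e choose r)"
    using assms r by (intro mult_le_mono1) auto
  ultimately have "m * (e choose m) \<le> (m + 2) * (e choose r)" by (simp only:)
  also have "\<dots> \<le> (2 * m) * (e choose r)"
    using assms(1) by (intro mult_le_mono1) simp
  finally have "e choose m \<le> 2 * (e choose r)"
    using assms(1) by simp
  moreover have "e choose r \<le> binsum e r"
    unfolding binsum_def by (rule member_le_sum) auto
  ultimately have "binsum e m \<le> 3 * binsum e r"
    by (simp add: r binsum_Suc)
  moreover have "2 ^ e \<le> 2 * binsum e m"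
    using assms(2) by (intro two_power_le_binsum) auto
  ultimately show ?thesis by (simp add: r)
qed

text \<open>With \<open>k = m + 2\<close>, words without quadratic factor cover half of
  \<open>2 ^ d\<close>, and those with one number at least \<open>d / 6 * 2 ^ (d - 1)\<close>, the
  other half. As \<open>log 2 n \<ge> d - 1\<close>, the base is at most 19/6.\<close>

lemma admissible_above_half:
  assumes "13 \<le> d" "2 ^ (d - 1) < n" "n \<le> 2 ^ d"
  shows "\<exists>k. admissible d n k"
proof -
  define m where "m = (d - 1) div 2"
  have m: "2 \<le> m" "d - 1 = 2 * m \<or> d - 1 = 2 * m + 1" using assms(1) by (auto simp: m_def)
  have two: "(2::nat) ^ d = 2 * 2 ^ (d - 1)" using assms(1) by (cases d) auto
  have "2 ^ d \<le> 2 * binsum d (m + 2)"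
    using m by (intro two_power_le_binsum) auto
  moreover have "6 * 2 ^ (d - 1) \<le> d * 2 ^ (d - 1)"
    using assms(1) by (intro mult_le_mono1) simp
  moreover have "d * 2 ^ (d - 1) \<le> d * (6 * binsum (d - 1) (m - 1))"
    by (intro mult_le_mono2 binsum_below_half m)
  moreover have "d * (6 * binsum (d - 1) (m - 1)) = 6 * (d * binsum (d - 1) (m - 1))"
    by simp
  ultimately have "2 ^ d \<le> binsum d (m + 2) + d * binsum (d - 1) (m - 1)"
    using two by linarith
  then have count: "n \<le> count_words d (m + 2)"
    using assms(3) m(1) by (simp add: count_words_def)
  have "(1 + 2 * real d * real 1 / real (d - 1)) \<le> 19/6"
    using assms(1) by (simp add: divide_simps of_nat_diff)
  then have "(1 + 2 * real d * real 1 / real (d - 1)) ^ (m + 1) \<le> (19/6) ^ (m + 1)"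
    by (intro power_mono) auto
  also have "\<dots> \<le> 2 ^ (d - 1)"
  proof (rule power2_le_imp_le)
    \<comment> \<open>Since \<open>2 * (m + 1) \<le> d + 1\<close>, the squared claim follows from
      an inequality in \<open>d\<close> alone, whose sides grow by the factors 19/6 and 4.\<close>
    have *: "(19/6 :: real) ^ (e + 1) \<le> 4 ^ (e - 1)" if "13 \<le> e" for e
      using that
    proof (induction e rule: nat_induct_at_least)
      case base
      show ?case by (simp add: power_divide)
    next
      case (Suc e)
      have "(19/6 :: real) ^ (Suc e + 1) = 19/6 * (19/6) ^ (e + 1)" by simp
      also have "\<dots> \<le> 4 * 4 ^ (e - 1)" by (intro mult_mono Suc.IH) auto
      also have "\<dots> = 4 ^ (Suc e - 1)" using Suc.hyps by (cases e) auto
      finally show ?case .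
    qed
    have "((19/6 :: real) ^ (m + 1))\<^sup>2 = (19/6) ^ (2 * (m + 1))" by (simp only: power_mult mult.commute)
    also have "\<dots> \<le> (19/6) ^ (d + 1)" using m assms(1) by (intro power_increasing) auto
    also have "\<dots> \<le> 4 ^ (d - 1)" by (rule *[OF assms(1)])
    also have "(4::real) ^ (d - 1) = (2 ^ (d - 1))\<^sup>2"
      by (simp add: power2_eq_square flip: power_mult_distrib)
    finally show "((19/6 :: real) ^ (m + 1))\<^sup>2 \<le> (2 ^ (d - 1))\<^sup>2" .
  qed simp
  also have "\<dots> \<le> real n"
    using assms(2) by (simp add: numeral_power_le_of_nat_cancel_iff less_imp_le)
  finally show ?thesis
    using assms(1,2) by (intro admissibleI[OF count, of "d - 1" 1]) auto
qed

text \<open>A table of witnesses. The instances of \<open>*\<close> are \<open>k\<close>, the least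
  \<open>n\<close> of the range as \<open>a\<close>, and \<open>p\<close>, \<open>q\<close> with
  \<open>p / q \<le> log 2 a\<close>.\<close>

lemma admissible_small_above_half:
  assumes "2 \<le> d" "d \<le> 12" "2 ^ (d - 1) < n" "n \<le> 2 ^ d" "binsum d 1 < n" "\<not> (d = 3 \<and> n = 8)"
  shows "\<exists>k. admissible d n k"
proof -
  have range: "d \<in> {2, 3, 4, 5, 6, 7, 8, 9, 10, 11, 12}" using assms(1,2) unfolding insert_iff empty_iff by arith
  have pow: "a ^ q \<le> n ^ q" if "a \<le> n" for a q :: nat using that by (rule power_mono) simp
  have *: "\<exists>k. admissible d n k"
    if "n \<le> count_words d k" "1 \<le> k" "a \<le> n" "2 ^ p \<le> a ^ q" "0 < p" "0 < q"
      "(1 + 2 * real d * real q / real p) ^ (k - 1) \<le> real a" for k p q a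
  proof (rule admissibleI[OF that(1,2) _ that(5,6)])
    show "2 ^ p \<le> n ^ q" using that(4) pow[OF that(3), of q] by simp
    show "(1 + 2 * real d * real q / real p) ^ (k - 1) \<le> real n" using that(3,7) by linarith
  qed
  note counts = count_words_def binsum_eval power_divide
  show ?thesis
    using range
  proof (elim insertE emptyE)
    assume d: "d = 2"
    then show ?thesis using assms by (intro *[of 2 4 2 1]) (simp_all add: counts)
  next
    assume d: "d = 3"
    then show ?thesis using assms by (intro *[of 2 5 2 1]) (simp_all add: counts)
  next
    assume d: "d = 4"
    show ?thesis
    \<comment> \<open>Since \<open>count_words 4 2 = 11\<close>, larger \<open>n\<close> require the
      next \<open>k\<close>. The splits at 31 and 48 for \<open>d = 5\<close> and
      \<open>d = 6\<close> arise in the same way from \<open>k = 3\<close>.\<close>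
    proof (cases "n \<le> 11")
      case True
      then show ?thesis using d assms by (intro *[of 2 9 3 1]) (simp_all add: counts)
    next
      case False
      then show ?thesis using d assms by (intro *[of 3 12 7 2]) (simp_all add: counts)
    qed
  next
    assume d: "d = 5"
    show ?thesis
    proof (cases "n \<le> 31")
      case True
      then show ?thesis using d assms by (intro *[of 3 17 4 1]) (simp_all add: counts)
    next
      case False
      then show ?thesis using d assms by (intro *[of 4 32 5 1]) (simp_all add: counts)
    qed
  next
    assume d: "d = 6"
    show ?thesis
    proof (cases "n \<le> 48")
      case True
      then show ?thesis using d assms by (intro *[of 3 33 5 1]) (simp_all add: counts)
    next
      case False
      then show ?thesis using d assms by (intro *[of 4 49 5 1]) (simp_all add: counts)
    qed
  next
    assume d: "d = 7"
    then show ?thesis using assms by (intro *[of 4 65 6 1]) (simp_all add: counts)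
  next
    assume d: "d = 8"
    then show ?thesis using assms by (intro *[of 5 129 7 1]) (simp_all add: counts)
  next
    assume d: "d = 9"
    then show ?thesis using assms by (intro *[of 5 257 8 1]) (simp_all add: counts)
  next
    assume d: "d = 10"
    then show ?thesis using assms by (intro *[of 6 513 9 1]) (simp_all add: counts)
  next
    assume d: "d = 11"
    then show ?thesis using assms by (intro *[of 6 1025 10 1]) (simp_all add: counts)
  next
    assume d: "d = 12"
    then show ?thesis using assms by (intro *[of 7 2049 11 1]) (simp_all add: counts)
  qed
qed

text \<open>At \<open>d = 3\<close>, \<open>n = 8\<close> no integer \<open>k\<close> works.\<close>

lemma admissible_exists:
  assumes "1 \<le> d" "d < n" "n \<le> 2 ^ d" "\<not> (d = 3 \<and> n = 8)"
  shows "\<exists>k. admissible d n k"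
proof -
  \<comment> \<open>Brackets \<open>n\<close> between the consecutive partial sums at
    \<open>m - 1\<close> and \<open>m\<close>; \<open>m\<close> is positive because
    \<open>binsum d 0 = 1 < n\<close>.\<close>
  define m where "m = (LEAST k. n \<le> binsum d k)"
  have m: "n \<le> binsum d m"
    unfolding m_def by (rule LeastI[of _ d]) (simp add: binsum_self assms)
  have m_le: "m \<le> d"
    unfolding m_def by (rule Least_le) (simp add: binsum_self assms)
  have "m \<noteq> 0"
  proof
    assume "m = 0"
    then show False using m assms by (simp add: binsum_eval)
  qed
  then obtain k where k: "m = Suc k" by (cases m) auto
  have less: "binsum d k < n"
    using not_less_Least[of k "\<lambda>k. n \<le> binsum d k"] k unfolding m_def by auto
  consider "3 * k \<le> d" | "d < 3 * k" "n \<le> 2 ^ (d - 1)" | "d < 3 * k" "2 ^ (d - 1) < n"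
    by linarith
  then show ?thesis
  proof cases
    case 1
    then show ?thesis using admissible_if_sparse[OF less] m k by auto
  next
    case 2
    then show ?thesis using admissible_if_half[OF less] m k by auto
  next
    case 3
    have "2 \<le> d" "1 \<le> k" using 3 k m_le by auto
    then have "binsum d 1 < n" using binsum_mono[of 1 k d] less by simp
    with \<open>2 \<le> d\<close> show ?thesis
      using admissible_above_half[of d n] admissible_small_above_half[of d n] 3 assms
      by (cases "d \<le> 12") auto
  qed
qed

subsection \<open>The lower bound\<close>

lemma sum_le_exp:
  fixes x :: real
  assumes "0 \<le> x"
  shows "(\<Sum>i<n. x ^ i / fact i) \<le> exp x"
proof -
  have "(\<Sum>i<n. x ^ i /\<^sub>R fact i) \<le> (\<Sum>i. x ^ i /\<^sub>R fact i)"
    using assms by (intro sum_le_suminf summable_exp_generic) auto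
  then show ?thesis by (simp add: exp_def divide_inverse mult.commute)
qed

text \<open>As 2 * 1.2825 = 3 * 171/200, it suffices that the cube of eight Taylor terms of
  \<open>exp (171/200)\<close> exceeds 13.\<close>

lemma ln_13_le: "ln 13 \<le> (2 * 1.2825 :: real)"
proof -
  have "(13::real) \<le> (235134 / 100000) ^ 3" by (simp add: power_divide)
  also have "\<dots> \<le> exp (171/200) ^ 3"
  proof (rule power_mono)
    have "235134 / 100000 \<le> (\<Sum>i<8. (171/200 :: real) ^ i / fact i)"
      by (simp add: eval_nat_numeral fact_numeral)
    also have "\<dots> \<le> exp (171/200)" by (rule sum_le_exp) simp
    finally show "235134 / 100000 \<le> exp (171/200 :: real)" .
  qed simp
  also have "\<dots> = exp (2 * 1.2825)" by (simp flip: exp_of_nat_mult)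
  finally have "ln 13 \<le> ln (exp (2 * 1.2825 :: real))"
    by (subst ln_le_cancel_iff) auto
  then show ?thesis by simp
qed

text \<open>The fraction lies between 1.2825/1.17, as the bound on \<open>c\<close> demands, and
  \<open>ln 3\<close>. With \<open>e < 2.72\<close> it reduces to comparing integer powers.\<close>

lemma ln_3_ge: "34/31 \<le> ln (3::real)"
proof -
  have "exp (34/31 :: real) ^ 31 = exp 1 ^ 34"
    by (simp flip: exp_of_nat_mult)
  also have "\<dots> \<le> (272/100) ^ 34"
    using e_less_272 by (intro power_mono) auto
  also have "\<dots> \<le> 3 ^ 31" by (simp add: power_divide)
  finally have "exp (34/31 :: real) \<le> 3" by (rule power_le_imp_le_base[of _ 30 _, simplified]) simp
  then show ?thesis by (subst ln_ge_iff) auto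
qed

text \<open>The hypothesis says \<open>r - 1 \<le> ln n / ln b\<close>, and
  \<open>ln 13 / 2 \<le> 1.2825\<close> turns this into the claim. The exponent \<open>r\<close> is
  real so that 13/5 can be used in the exceptional case.\<close>

lemma lower_bound_square_le:
  fixes r :: real
  assumes "1 \<le> d" "2 \<le> n" "1 \<le> r"
    and B: "(1 + 2 * real d / log 2 (real n)) powr (r - 1) \<le> real n"
  shows "(0.27 * real n powr - (1.2825 / ln (1 + 2 * real d / log 2 (real n))))\<^sup>2 \<le> 13 powr - r"
proof -
  define b where "b = 1 + 2 * real d / log 2 (real n)"
  define t where "t = 1.2825 / ln b * ln (real n)"
  have "log 2 (real n) > 0" using assms(2) by simp
  then have b: "b > 1" using assms(1) by (simp add: b_def)
  have "(r - 1) * ln b = ln (b powr (r - 1))" using b by (simp add: ln_powr)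
  also have "\<dots> \<le> ln (real n)"
    using B b assms(2) by (subst ln_le_cancel_iff) (auto simp: b_def)
  finally have "r - 1 \<le> ln (real n) / ln b" using b by (simp add: pos_le_divide_eq)
  then have "ln 13 / 2 * (r - 1) \<le> 1.2825 * (ln (real n) / ln b)"
    using ln_13_le assms(3) by (intro mult_mono) auto
  then have t: "ln 13 * (r - 1) \<le> 2 * t" by (simp add: t_def)
  have "(0.27 * real n powr - (1.2825 / ln b))\<^sup>2 = 0.0729 * exp (- (2 * t))"
    using assms(2)
    by (simp add: powr_def t_def power_mult_distrib power2_eq_square flip: exp_add)
  \<comment> \<open>The square 0.0729 of 0.27 is below 1/13.\<close>
  also have "\<dots> \<le> 1/13 * exp (- (ln 13 * (r - 1)))"
    using t by (intro mult_mono) auto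
  also have "\<dots> = 13 powr - r"
    by (simp add: powr_def algebra_simps exp_diff exp_minus inverse_eq_divide)
  finally show ?thesis by (simp add: b_def)
qed

theorem corollary6:
  fixes d n :: nat and s :: enat
  defines "c \<equiv> 1.2825 / ln (1 + 2 * real d / log 2 (real n))"
  assumes "d \<ge> 1" and "s \<ge> 1" and "d < n" and "n \<le> 2 ^ d"
  shows "sobolev_mix_approx_number n s d \<ge> ereal (0.27 * real n powr (- c)) \<and> c \<le> 1.17"
proof
  have n: "2 \<le> n" using assms by simp
  define b where "b = 1 + 2 * real d / log 2 (real n)"
  have L: "0 < log 2 (real n)" "log 2 (real n) \<le> real d"
    using n assms(5) by (simp_all add: log_le_iff powr_realpow numeral_power_le_of_nat_cancel_iff)
  \<comment> \<open>As \<open>n \<le> 2 ^ d\<close> gives \<open>log 2 n \<le> d\<close>, the second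
    summand of \<open>b\<close> is at least 2.\<close>
  have "3 \<le> b" using L by (simp add: b_def divide_simps)
  have "ln 3 \<le> ln b" using \<open>3 \<le> b\<close> by (subst ln_le_cancel_iff) auto
  then have "34/31 \<le> ln b" using ln_3_ge by linarith
  then show "c \<le> 1.17" unfolding c_def b_def[symmetric] by (simp add: divide_simps)
  define \<epsilon> where "\<epsilon> = 0.27 * real n powr (- c)"
  have "0 \<le> \<epsilon>" by (simp add: \<epsilon>_def)
  have sq: "\<epsilon>\<^sup>2 \<le> 13 powr - r" if "1 \<le> r" "b powr (r - 1) \<le> real n" for r
    using lower_bound_square_le[OF assms(2) n that(1)] that(2) by (simp add: \<epsilon>_def c_def b_def)
  have fifth_root: "(x ^ m) powr (1/5) = x powr (real m / 5)" if "0 < x" for x :: real and m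
    using that by (simp add: powr_powr flip: powr_realpow)
  have "ereal \<epsilon> \<le> sobolev_mix_approx_number n s d"
  proof (cases "d = 3 \<and> n = 8")
    case True
    txt \<open>Counting a quadratic factor as \<open>13/5\<close> linear ones is enough here, as \<open>781\<^sup>5 \<le> 13\<^sup>1\<^sup>3\<close>.\<close>
    have "log 2 8 = (3::real)" using log_nat_power[of 2 2 3] by simp
    then have "b = 3" using True by (simp add: b_def)
    \<comment> \<open>The exponent 8/5 is \<open>r - 1\<close> for \<open>r = 13/5\<close>.\<close>
    have "(3::real) powr (8/5) = (3 ^ 8) powr (1/5)"
      using fifth_root[of 3 8] by simp
    also have "\<dots> \<le> (8 ^ 5) powr (1/5)" by (intro powr_mono2) auto
    also have "\<dots> = 8" using fifth_root[of 8 5] by simp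
    finally have "\<epsilon>\<^sup>2 \<le> 13 powr - (13/5)"
      using True \<open>b = 3\<close> by (intro sq) auto
    moreover have "(13::real) powr - (13/5) \<le> 1/781"
    proof -
      have "(781::real) = (781 ^ 5) powr (1/5)" using fifth_root[of 781 5] by simp
      also have "\<dots> \<le> (13 ^ 13) powr (1/5)" by (intro powr_mono2) auto
      also have "\<dots> = 13 powr (13/5)" using fifth_root[of 13 13] by simp
      finally show ?thesis by (simp add: powr_minus_divide divide_simps)
    qed
    ultimately have "\<epsilon>\<^sup>2 \<le> 1/781" by linarith
    then show ?thesis
      \<comment> \<open>Seven words with at most two linear factors and three with a single
        quadratic one exceed \<open>n = 8\<close>.\<close>
      using True by (intro approx_number_ge_binsum2[OF assms(3) \<open>0 \<le> \<epsilon>\<close>, where k = 2 and l = 0])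
        (simp_all add: binsum_eval power_divide)
  next
    case False
    then obtain k where k: "n \<le> count_words d k" "1 \<le> k" "b ^ (k - 1) \<le> real n"
      using admissible_exists[of d n] assms by (auto simp: admissible_def b_def)
    have "real k - 1 = real (k - 1)" using k(2) by simp
    then have "b powr (real k - 1) = b ^ (k - 1)"
      using \<open>3 \<le> b\<close> by (simp only: powr_realpow)
    with k(3) have "b powr (real k - 1) \<le> real n" by simp
    then have "\<epsilon>\<^sup>2 \<le> 13 powr - real k" using k(2) by (intro sq) auto
    then have \<epsilon>: "\<epsilon>\<^sup>2 \<le> (1/13) ^ k"
      by (simp add: powr_minus_divide powr_realpow power_divide)
    show ?thesis
    proof (cases "k < 3")
      case True
      then show ?thesis
        using k(1) by (intro approx_number_ge_binsum[OF assms(3) \<open>0 \<le> \<epsilon>\<close> _ \<epsilon>]) (simp add: count_words_def)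
    next
      case False
      define l where "l = k - 3"
      \<comment> \<open>The denominator 2197 is the cube of 13, the price of the quadratic
        factor.\<close>
      have "(1/13 :: real) ^ k = (1/13) ^ l / 2197"
        using False by (simp add: l_def power_diff divide_simps)
      also have "\<dots> \<le> (1/13) ^ l / 781" by (intro divide_left_mono) auto
      finally show ?thesis
        using k(1) False \<epsilon>
        by (intro approx_number_ge_binsum2[OF assms(3) \<open>0 \<le> \<epsilon>\<close> _ \<epsilon>, where l = l])
          (auto simp: count_words_def l_def)
    qed
  qed
  then show "sobolev_mix_approx_number n s d \<ge> ereal (0.27 * real n powr (- c))"
    by (simp add: \<epsilon>_def)
qed

end
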